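(* Let $M$ be a $2$-dimensional manifold, let $\mathcal{F}$ be a rank $1$, strictly affine point-affine distribution of constant type on $M$, and let $Q:\mathcal{F}\to\mathbb{R}$ be a positive definite quadratic cost functional on $\mathcal{F}$. If the structure $(\mathcal{F},Q)$ is homogeneous, then $(\mathcal{F},Q)$ is locally point-affine equivalent (by a local point-affine isometry, i.e. respecting the drift field, the distribution and the cost functional) to a structure, on an open subset of $\mathbb{R}^2$ with coordinates $(x^1,x^2)$, of the form $$\mathcal{F}=v_1+\operatorname{span}(v_2),\qquad Q(v_1+u\,v_2)=\tfrac12 G(x)\,u^2,$$ with distinguished drift vector field $v_1$, where the triple $(v_1,v_2,G(x))$ is one of the following: (1.1) $v_1=\frac{\partial}{\partial x^1}$, $\;v_2=\frac{\partial}{\partial x^2}$, $\;G(x)=e^{2c_1x^1}$, for some real constant $c_1$; (1.2) $v_1=x^2\left(\frac{\partial}{\partial x^1}+j_0\frac{\partial}{\partial x^2}\right)$, $\;v_2=x^2\frac{\partial}{\partial x^2}$, $\;G(x)=g_0$, for some real constants $j_0$ and $g_0>0$ (on an open set where $x^2\neq 0$).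
   Context: All objects are smooth. A rank-$s$ point-affine distribution on an $n$-manifold $M$ is a sub-bundle $\mathcal{F}\subset TM$ whose fiber $\mathcal{F}_x=T_xM\cap\mathcal{F}$ at each $x\in M$ is an $s$-dimensional affine subspace of $T_xM$ containing a distinguished point, the distinguished points forming a vector field called the drift vector field. In the rank $1$ case, locally $\mathcal{F}_x=v_1(x)+\operatorname{span}(v_2(x))$, where $v_1$ is the drift vector field and $v_2$ is a nowhere vanishing vector field. The distribution is strictly affine if no fiber $\mathcal{F}_x$ is a linear subspace of $T_xM$; in rank $1$ this means that $v_1,v_2$ are linearly independent at every point. For a rank $1$ strictly affine point-affine distribution on a surface, constant type means that the pointwise relation $[v_1,v_2](x)\in\operatorname{span}(v_2(x))$ (which does not depend on the choice of $v_2$) either holds at every point or holds at no point. A positive definite quadratic cost functional is a function $Q:\mathcal{F}\to\mathbb{R}$ which, in a local framing, is a positive definite quadratic form in the control coordinates with smooth coefficients; in rank $1$, $Q(v_1(x)+u\,v_2(x))=\frac12G(x)u^2$ with $G>0$ smooth. A local point-affine isometry between two such structures is a local diffeomorphism whose derivative maps one drift vector field to the other and one affine distribution to the other, and which carries one cost functional to the other. The structure $(\mathcal{F},Q)$ is homogeneous if its (local) symmetries, i.e. local point-affine self-isometries, act transitively on $M$. "Locally equivalent" means that every point of $M$ has a neighborhood that is related to the indicated model by such a local isometry. *)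

theory Defs
  imports "HOL-Analysis.Analysis" "HOL-Library.Function_Algebras"
begin

section \<open>Smooth maps between Euclidean spaces\<close>

text \<open>The set \<open>S\<close> is always open below, so the derivatives taken in the ambient space only depend
  on the values of \<open>f\<close> on \<open>S\<close>.\<close>

primrec Ck_on :: "nat \<Rightarrow> 'a::euclidean_space set \<Rightarrow> ('a \<Rightarrow> 'b::real_normed_vector) \<Rightarrow> bool" where
  "Ck_on 0 S f \<longleftrightarrow> continuous_on S f"
| "Ck_on (Suc k) S f \<longleftrightarrow>
     (\<forall>x\<in>S. f differentiable (at x)) \<and> (\<forall>v. Ck_on k S (\<lambda>x. frechet_derivative f (at x) v))"

definition smooth_on :: "'a::euclidean_space set \<Rightarrow> ('a \<Rightarrow> 'b::real_normed_vector) \<Rightarrow> bool" where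
  "smooth_on S f \<longleftrightarrow> (\<forall>k. Ck_on k S f)"


section \<open>Smooth manifolds\<close>

text \<open>A chart \<open>(U, \<phi>)\<close> has domain \<open>U\<close>; the values of \<open>\<phi>\<close> outside \<open>U\<close> are irrelevant.
  The dimension of the manifold is the dimension of the model space \<open>'e\<close>. Atlases are not
  required to be maximal.\<close>

type_synonym ('m, 'e) chart = "'m set \<times> ('m \<Rightarrow> 'e)"

abbreviation chart_inv :: "('m, 'e) chart \<Rightarrow> 'e \<Rightarrow> 'm" where
  "chart_inv c \<equiv> inv_into (fst c) (snd c)"

record ('m, 'e) smooth_space =
  topo :: "'m topology"
  atlas :: "('m, 'e) chart set"

abbreviation points :: "('m, 'e, 'z) smooth_space_scheme \<Rightarrow> 'm set" where
  "points M \<equiv> topspace (topo M)"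

definition smooth_manifold :: "('m, 'e::euclidean_space, 'z) smooth_space_scheme \<Rightarrow> bool" where
  "smooth_manifold M \<longleftrightarrow>
     Hausdorff_space (topo M) \<and> second_countable (topo M) \<and>
     (\<Union>c\<in>atlas M. fst c) = points M \<and>
     (\<forall>c\<in>atlas M. openin (topo M) (fst c) \<and> open (snd c ` fst c) \<and>
        homeomorphic_map (subtopology (topo M) (fst c)) (top_of_set (snd c ` fst c)) (snd c)) \<and>
     (\<forall>c\<in>atlas M. \<forall>d\<in>atlas M. smooth_on (snd c ` (fst c \<inter> fst d)) (snd d \<circ> chart_inv c))"

definition smooth_function ::
  "('m, 'e::euclidean_space, 'z) smooth_space_scheme \<Rightarrow> 'm set \<Rightarrow> ('m \<Rightarrow> real) \<Rightarrow> bool" where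
  "smooth_function M W g \<longleftrightarrow> (\<forall>c\<in>atlas M. smooth_on (snd c ` (fst c \<inter> W)) (g \<circ> chart_inv c))"

text \<open>For continuous \<open>f\<close> only.\<close>

definition smooth_map :: "('m, 'e::euclidean_space, 'z) smooth_space_scheme \<Rightarrow>
    ('n, 'f::euclidean_space, 'y) smooth_space_scheme \<Rightarrow> 'm set \<Rightarrow> ('m \<Rightarrow> 'n) \<Rightarrow> bool" where
  "smooth_map M N W f \<longleftrightarrow> (\<forall>c\<in>atlas M. \<forall>d\<in>atlas N.
     smooth_on (snd c ` (fst c \<inter> W \<inter> f -` fst d)) (snd d \<circ> f \<circ> chart_inv c))"

definition diffeomorphism_between :: "('m, 'e::euclidean_space, 'z) smooth_space_scheme \<Rightarrow>
    ('n, 'f::euclidean_space, 'y) smooth_space_scheme \<Rightarrow>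
    'm set \<Rightarrow> 'n set \<Rightarrow> ('m \<Rightarrow> 'n) \<Rightarrow> bool" where
  "diffeomorphism_between M N U V f \<longleftrightarrow>
     openin (topo M) U \<and> openin (topo N) V \<and>
     homeomorphic_map (subtopology (topo M) U) (subtopology (topo N) V) f \<and>
     smooth_map M N U f \<and> smooth_map N M V (inv_into U f)"


section \<open>Tangent vectors\<close>

text \<open>A tangent vector at \<open>x\<close> is a family of coordinate vectors, one for each chart around \<open>x\<close>,
  that transforms by the derivatives of the transition maps (and is zero at all other arguments).
  With the pointwise operations on functions the tangent spaces are linear subspaces of the type of
  all such families, so that \<^const>\<open>span\<close>, \<^const>\<open>subspace\<close> and \<^const>\<open>independent\<close> apply.\<close>

instantiation "fun" :: (type, real_vector) real_vector
begin

definition scaleR_fun_def: "r *\<^sub>R f = (\<lambda>x. r *\<^sub>R f x)"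

instance
  by standard (simp_all add: scaleR_fun_def fun_eq_iff algebra_simps)

end

type_synonym ('m, 'e) tvec = "('m, 'e) chart \<Rightarrow> 'e"

definition tangent_space ::
  "('m, 'e::euclidean_space, 'z) smooth_space_scheme \<Rightarrow> 'm \<Rightarrow> ('m, 'e) tvec set" where
  "tangent_space M x =
     {v. (\<forall>c\<in>atlas M. \<forall>d\<in>atlas M. x \<in> fst c \<longrightarrow> x \<in> fst d \<longrightarrow>
            v d = frechet_derivative (snd d \<circ> chart_inv c) (at (snd c x)) (v c)) \<and>
         (\<forall>c. c \<notin> atlas M \<or> x \<notin> fst c \<longrightarrow> v c = 0)}"

definition tangent_bundle ::
  "('m, 'e::euclidean_space, 'z) smooth_space_scheme \<Rightarrow> ('m \<times> ('m, 'e) tvec) set" where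
  "tangent_bundle M = Sigma (points M) (tangent_space M)"

text \<open>The derivative of a map; it does not depend on the chart chosen around \<open>x\<close>.\<close>

definition tangent_map :: "('m, 'e::euclidean_space, 'z) smooth_space_scheme \<Rightarrow>
    ('n, 'f::euclidean_space, 'y) smooth_space_scheme \<Rightarrow>
    ('m \<Rightarrow> 'n) \<Rightarrow> 'm \<Rightarrow> ('m, 'e) tvec \<Rightarrow> ('n, 'f) tvec" where
  "tangent_map M N f x v =
     (let c = (SOME c. c \<in> atlas M \<and> x \<in> fst c) in
      (\<lambda>d. if d \<in> atlas N \<and> f x \<in> fst d
           then frechet_derivative (snd d \<circ> f \<circ> chart_inv c) (at (snd c x)) (v c)
           else 0))"

definition smooth_vector_field :: "('m, 'e::euclidean_space, 'z) smooth_space_scheme \<Rightarrow>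
    'm set \<Rightarrow> ('m \<Rightarrow> ('m, 'e) tvec) \<Rightarrow> bool" where
  "smooth_vector_field M W X \<longleftrightarrow>
     (\<forall>x\<in>W. X x \<in> tangent_space M x) \<and>
     (\<forall>c\<in>atlas M. smooth_on (snd c ` (fst c \<inter> W)) (\<lambda>y. X (chart_inv c y) c))"

text \<open>In each chart, \<open>[X,Y] = DY(X) - DX(Y)\<close>.\<close>

definition lie_bracket :: "('m, 'e::euclidean_space, 'z) smooth_space_scheme \<Rightarrow>
    ('m \<Rightarrow> ('m, 'e) tvec) \<Rightarrow> ('m \<Rightarrow> ('m, 'e) tvec) \<Rightarrow> 'm \<Rightarrow> ('m, 'e) tvec" where
  "lie_bracket M X Y x =
     (\<lambda>c. if c \<in> atlas M \<and> x \<in> fst c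
          then frechet_derivative (\<lambda>y. Y (chart_inv c y) c) (at (snd c x)) (X x c)
             - frechet_derivative (\<lambda>y. X (chart_inv c y) c) (at (snd c x)) (Y x c)
          else 0)"


section \<open>Point-affine distributions with quadratic cost\<close>

text \<open>The distribution is a subset of the tangent bundle; its fiber at \<open>x\<close> is \<open>affdist S `` {x}\<close>.
  The values of \<^term>\<open>drift\<close> outside the manifold and of \<^term>\<open>cost\<close> outside the distribution
  are irrelevant.\<close>

record ('m, 'e) affine_structure = "('m, 'e) smooth_space" +
  drift :: "'m \<Rightarrow> ('m, 'e) tvec"
  affdist :: "('m \<times> ('m, 'e) tvec) set"
  cost :: "'m \<times> ('m, 'e) tvec \<Rightarrow> real"

text \<open>A local framing of rank \<open>s\<close> on \<open>W\<close>: smooth vector fields \<open>w 0, ..., w (s - 1)\<close>, linearly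
  independent at each point, spanning the direction spaces of the fibers.\<close>

definition local_framing :: "('m, 'e::euclidean_space, 'z) affine_structure_scheme \<Rightarrow> nat \<Rightarrow>
    'm set \<Rightarrow> (nat \<Rightarrow> 'm \<Rightarrow> ('m, 'e) tvec) \<Rightarrow> bool" where
  "local_framing S s W w \<longleftrightarrow>
     openin (topo S) W \<and>
     (\<forall>i<s. smooth_vector_field S W (w i)) \<and>
     (\<forall>x\<in>W. inj_on (\<lambda>i. w i x) {..<s} \<and> independent ((\<lambda>i. w i x) ` {..<s}) \<and>
        affdist S `` {x} = (\<lambda>v. drift S x + v) ` span ((\<lambda>i. w i x) ` {..<s}))"

definition point_affine_distribution ::
  "nat \<Rightarrow> ('m, 'e::euclidean_space, 'z) affine_structure_scheme \<Rightarrow> bool" where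
  "point_affine_distribution s S \<longleftrightarrow>
     affdist S \<subseteq> tangent_bundle S \<and>
     smooth_vector_field S (points S) (drift S) \<and>
     (\<forall>p\<in>points S. \<exists>W w. p \<in> W \<and> local_framing S s W w)"

definition strictly_affine :: "('m, 'e::euclidean_space, 'z) affine_structure_scheme \<Rightarrow> bool" where
  "strictly_affine S \<longleftrightarrow> (\<forall>x\<in>points S. \<not> subspace (affdist S `` {x}))"

text \<open>For rank 1. The relation \<open>[v\<^sub>1, v\<^sub>2](x) \<in> span (v\<^sub>2(x))\<close> does not depend on the local framing
  \<open>v\<^sub>2\<close>.\<close>

definition bracket_in_span ::
  "('m, 'e::euclidean_space, 'z) affine_structure_scheme \<Rightarrow> 'm \<Rightarrow> bool" where
  "bracket_in_span S x \<longleftrightarrow>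
     (\<exists>W v\<^sub>2. x \<in> W \<and> local_framing S 1 W (\<lambda>_. v\<^sub>2) \<and> lie_bracket S (drift S) v\<^sub>2 x \<in> span {v\<^sub>2 x})"

definition constant_type :: "('m, 'e::euclidean_space, 'z) affine_structure_scheme \<Rightarrow> bool" where
  "constant_type S \<longleftrightarrow>
     (\<forall>x\<in>points S. bracket_in_span S x) \<or> (\<forall>x\<in>points S. \<not> bracket_in_span S x)"

definition positive_definite_quadratic_cost ::
  "nat \<Rightarrow> ('m, 'e::euclidean_space, 'z) affine_structure_scheme \<Rightarrow> bool" where
  "positive_definite_quadratic_cost s S \<longleftrightarrow>
     (\<forall>p\<in>points S. \<exists>W w g. p \<in> W \<and> local_framing S s W w \<and>
        (\<forall>i<s. \<forall>j<s. smooth_function S W (g i j)) \<and>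
        (\<forall>x\<in>W.
           (\<forall>i<s. \<forall>j<s. g i j x = g j i x) \<and>
           (\<forall>u::nat \<Rightarrow> real. (\<exists>i<s. u i \<noteq> 0) \<longrightarrow> (\<Sum>i<s. \<Sum>j<s. g i j x * u i * u j) > 0) \<and>
           (\<forall>u::nat \<Rightarrow> real. cost S (x, drift S x + (\<Sum>i<s. u i *\<^sub>R w i x))
              = 1/2 * (\<Sum>i<s. \<Sum>j<s. g i j x * u i * u j))))"

definition point_affine_isometry :: "('m, 'e::euclidean_space, 'z) affine_structure_scheme \<Rightarrow>
    ('n, 'f::euclidean_space, 'y) affine_structure_scheme \<Rightarrow>
    'm set \<Rightarrow> 'n set \<Rightarrow> ('m \<Rightarrow> 'n) \<Rightarrow> bool" where
  "point_affine_isometry S T U V f \<longleftrightarrow>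
     diffeomorphism_between S T U V f \<and>
     (\<forall>x\<in>U.
        tangent_map S T f x (drift S x) = drift T (f x) \<and>
        tangent_map S T f x ` (affdist S `` {x}) = affdist T `` {f x} \<and>
        (\<forall>v\<in>affdist S `` {x}. cost T (f x, tangent_map S T f x v) = cost S (x, v)))"

definition homogeneous :: "('m, 'e::euclidean_space, 'z) affine_structure_scheme \<Rightarrow> bool" where
  "homogeneous S \<longleftrightarrow>
     (\<forall>p\<in>points S. \<forall>q\<in>points S. \<exists>U V f. p \<in> U \<and> f p = q \<and> point_affine_isometry S S U V f)"

definition locally_equivalent :: "('m, 'e::euclidean_space, 'z) affine_structure_scheme \<Rightarrow>
    ('n, 'f::euclidean_space, 'y) affine_structure_scheme \<Rightarrow> bool" where
  "locally_equivalent S T \<longleftrightarrow>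
     (\<forall>p\<in>points S. \<exists>U V f. p \<in> U \<and> point_affine_isometry S T U V f)"


section \<open>Structures on open subsets of Euclidean space\<close>

definition standard_chart :: "'e set \<Rightarrow> ('e, 'e) chart" where
  "standard_chart \<Omega> = (\<Omega>, (\<lambda>x. x))"

text \<open>The tangent vector to \<open>\<Omega>\<close> with the given coordinates in the standard chart.\<close>

definition std_tvec :: "'e set \<Rightarrow> 'e::euclidean_space \<Rightarrow> ('e, 'e) tvec" where
  "std_tvec \<Omega> v = (\<lambda>c. if c = standard_chart \<Omega> then v else 0)"

text \<open>The structure \<open>T\<close> on the open set \<open>\<Omega>\<close> is \<open>v\<^sub>1 + span v\<^sub>2\<close> with drift \<open>v\<^sub>1\<close> and
  \<open>Q (v\<^sub>1 + u v\<^sub>2) = 1/2 G u\<^sup>2\<close>.\<close>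

definition rank1_structure_on :: "'e::euclidean_space set \<Rightarrow> ('e \<Rightarrow> 'e) \<Rightarrow> ('e \<Rightarrow> 'e) \<Rightarrow> ('e \<Rightarrow> real) \<Rightarrow>
    ('e, 'e) affine_structure \<Rightarrow> bool" where
  "rank1_structure_on \<Omega> v\<^sub>1 v\<^sub>2 G T \<longleftrightarrow>
     open \<Omega> \<and> topo T = top_of_set \<Omega> \<and> atlas T = {standard_chart \<Omega>} \<and>
     (\<forall>x\<in>\<Omega>. drift T x = std_tvec \<Omega> (v\<^sub>1 x)) \<and>
     affdist T = {(x, std_tvec \<Omega> (v\<^sub>1 x + u *\<^sub>R v\<^sub>2 x)) | x u. x \<in> \<Omega>} \<and>
     (\<forall>x\<in>\<Omega>. \<forall>u. cost T (x, std_tvec \<Omega> (v\<^sub>1 x + u *\<^sub>R v\<^sub>2 x)) = 1/2 * G x * u\<^sup>2)"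

end

theory Submission
  imports Defs
begin

text \<open>Choose a field \<open>B\<close> along the directions of the distribution with \<open>Q (A + u B) = u\<^sup>2/2\<close>, where
  \<open>A\<close> is the drift; it is unique up to sign, and \<open>A, B\<close> is a frame by strict affinity. Isometries
  preserve \<open>A\<close> and preserve \<open>B\<close> up to sign, so by homogeneity \<open>[A, B] = a A + b B\<close> with \<open>b\<close> and
  \<open>\<bar>a\<bar>\<close> constant. For the dual coframe \<open>\<alpha>, \<beta>\<close> this reads \<open>d\<alpha> = -a \<alpha> \<and> \<beta>\<close> and
  \<open>d\<beta> = -b \<alpha> \<and> \<beta>\<close>, and adapted coordinates come from the Poincare lemma alone:
  if \<open>a = 0\<close>, then \<open>\<alpha> = dx\<^sub>1\<close> and \<open>exp (b x\<^sub>1) \<beta> = dx\<^sub>2\<close>; if \<open>a \<noteq> 0\<close>, rescale \<open>B\<close> so that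
  \<open>a = -1\<close>, and then \<open>b \<alpha> + \<beta> = dz\<close>, \<open>exp z \<alpha> = dx\<^sub>1\<close>, \<open>x\<^sub>2 = exp z\<close>.\<close>

section \<open>Calculus of smooth maps\<close>

text \<open>The obstacle is the sign of \<open>B\<close>. An isometry may reverse \<open>B\<close>,
  so homogeneity pins down \<open>b\<close> but only \<open>a\<^sup>2\<close>, while one and the
  same model has to serve every point. The rescaling resolves this: near a given point the
  coefficient is continuous with constant nonzero square, hence constant, and multiplying
  \<open>B\<close> by minus its inverse absorbs sign and size together. All that survives of
  \<open>a\<close> is the cost of the rescaled field, g_0 = 1/a^2, which is blind to the sign. For a
  = 0 the model field is v_2 = exp(-b x_1) B, whence c_1 = -b; in the other case j_0 = b. In the
  plane a two-form is determined by its value on the frame, so closedness of a one-form is a single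
  scalar equation; the exponentials are the integrating factors that solve it. The coordinate maps
  are invertible because they carry one frame to another, and this same relation is a first-order
  equation for the inverse map, from which its smoothness is bootstrapped.\<close>

lemma Ck_on_subset: "Ck_on k S f \<Longrightarrow> T \<subseteq> S \<Longrightarrow> Ck_on k T f"
  by (induction k arbitrary: f) (auto intro: continuous_on_subset)

text \<open>On an open set the ambient derivative at a point depends only on nearby values, so both
  functions share it. The induction passes to directional derivatives, which is why both functions
  are generalised.\<close>

lemma Ck_on_cong:
  assumes "open S" "\<And>x. x \<in> S \<Longrightarrow> f x = g x" "Ck_on k S f"
  shows "Ck_on k S g"
  using assms(2,3)
proof (induction k arbitrary: f g)
  case 0
  then show ?case by (metis Ck_on.simps(1) continuous_on_cong)
next
  case (Suc k)
  have *: "(g has_derivative frechet_derivative f (at x)) (at x)" if "x \<in> S" for x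
  proof (rule has_derivative_transform_within_open[OF _ assms(1) that])
    show "(f has_derivative frechet_derivative f (at x)) (at x)"
      using Suc.prems(2) that by (simp add: frechet_derivative_works[symmetric])
  qed (rule Suc.prems(1))
  have eq: "frechet_derivative f (at x) v = frechet_derivative g (at x) v" if "x \<in> S" for x v
    using frechet_derivative_at[OF *[OF that]] by simp
  have "Ck_on k S (\<lambda>x. frechet_derivative g (at x) v)" for v
    by (rule Suc.IH[where f="\<lambda>x. frechet_derivative f (at x) v"]) (use Suc.prems(2) eq in auto)
  moreover have "\<forall>x\<in>S. g differentiable (at x)"
    using * by (auto simp: differentiable_def)
  ultimately show ?case by simp
qed

text \<open>Lets the derivative be supplied as an explicit formula \<open>F\<close>; the closure
  properties below then reduce to differentiation rules.\<close>

lemma Ck_on_SucI: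
  assumes "open S" "\<And>x. x \<in> S \<Longrightarrow> (f has_derivative F x) (at x)"
    "\<And>v. Ck_on k S (\<lambda>x. F x v)"
  shows "Ck_on (Suc k) S f"
proof -
  have "frechet_derivative f (at x) = F x" if "x \<in> S" for x
    using frechet_derivative_at[OF assms(2)[OF that]] by simp
  then have "Ck_on k S (\<lambda>x. frechet_derivative f (at x) v)" for v
    by (intro Ck_on_cong[OF assms(1) _ assms(3)[of v]]) simp
  then show ?thesis
    using assms(2) by (auto simp: differentiable_def)
qed

lemma Ck_on_has_derivative:
  assumes "Ck_on (Suc k) S f" "x \<in> S"
  shows "(f has_derivative frechet_derivative f (at x)) (at x)"
  using assms by (simp add: frechet_derivative_works[symmetric])

lemma Ck_on_deriv: "Ck_on (Suc k) S f \<Longrightarrow> Ck_on k S (\<lambda>x. frechet_derivative f (at x) v)"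
  by simp

lemma Ck_on_SucD: "Ck_on (Suc k) S f \<Longrightarrow> Ck_on k S f"
proof (induction k arbitrary: f)
  case 0
  then show ?case
    by (simp add: continuous_at_imp_continuous_on differentiable_imp_continuous_within)
next
  case (Suc k)
  have "\<forall>v. Ck_on k S (\<lambda>x. frechet_derivative f (at x) v)"
    by (rule allI, rule Suc.IH[OF Ck_on_deriv[OF Suc.prems]])
  with Suc.prems show ?case by simp
qed

lemma Ck_on_continuous: "Ck_on k S f \<Longrightarrow> continuous_on S f"
proof (induction k)
  case (Suc k)
  show ?case by (rule Suc.IH[OF Ck_on_SucD[OF Suc.prems]])
qed simp

lemma Ck_on_const:
  assumes "open S"
  shows "Ck_on k S (\<lambda>x. c)"
proof (induction k arbitrary: c)
  case (Suc k)
  show ?case by (rule Ck_on_SucI[OF assms has_derivative_const Suc])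
qed simp

lemma Ck_on_bounded_linear:
  assumes "open S" "bounded_linear L"
  shows "Ck_on k S L"
proof (cases k)
  case 0
  then show ?thesis using assms by (simp add: linear_continuous_on)
next
  case (Suc j)
  show ?thesis unfolding Suc
    by (rule Ck_on_SucI[OF assms(1) bounded_linear_imp_has_derivative[OF assms(2)] Ck_on_const[OF assms(1)]])
qed

lemma Ck_on_add:
  assumes "open S"
  shows "Ck_on k S f \<Longrightarrow> Ck_on k S g \<Longrightarrow> Ck_on k S (\<lambda>x. f x + g x)"
proof (induction k arbitrary: f g)
  case 0
  then show ?case by (simp add: continuous_on_add)
next
  case (Suc k)
  note hd = Suc.prems[THEN Ck_on_has_derivative] and D = Suc.prems[THEN Ck_on_deriv]
  show ?case
    by (rule Ck_on_SucI[OF assms has_derivative_add[OF hd] Suc.IH[OF D]])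
qed

lemma Ck_on_sum:
  assumes "open S" "\<And>i. i \<in> I \<Longrightarrow> Ck_on k S (f i)"
  shows "Ck_on k S (\<lambda>x. \<Sum>i\<in>I. f i x)"
  using assms(2)
  by (induction I rule: infinite_finite_induct) (auto intro!: Ck_on_const Ck_on_add assms(1))

text \<open>The product rule writes the derivative as a sum of two pairings of the same kind, one
  factor differentiated and the other regarded as one order less smooth. Scalar multiplication,
  inner product and multiplication are all instances.\<close>

lemma Ck_on_bilinear:
  assumes "bounded_bilinear p" "open S"
  shows "Ck_on k S f \<Longrightarrow> Ck_on k S g \<Longrightarrow> Ck_on k S (\<lambda>x. p (f x) (g x))"
proof (induction k arbitrary: f g)
  case 0
  then show ?case by (simp add: bounded_bilinear.continuous_on[OF assms(1)])
next
  case (Suc k)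
  note hd = Suc.prems[THEN Ck_on_has_derivative] and D = Suc.prems[THEN Ck_on_deriv]
    and low = Suc.prems[THEN Ck_on_SucD]
  show ?case
    by (rule Ck_on_SucI[OF assms(2) bounded_bilinear.FDERIV[OF assms(1) hd]
          Ck_on_add[OF assms(2) Suc.IH[OF low(1) D(2)] Suc.IH[OF D(1) low(2)]]])
qed

lemmas Ck_on_scaleR = Ck_on_bilinear[OF bounded_bilinear_scaleR]
  and Ck_on_inner = Ck_on_bilinear[OF bounded_bilinear_inner]
  and Ck_on_mult = Ck_on_bilinear[OF bounded_bilinear_mult]

text \<open>\<open>Ck_on\<close> controls derivatives in fixed directions only. This expansion
  reduces a direction that varies with the point to finitely many fixed ones.\<close>

lemma linear_expand_Basis:
  fixes L :: "'a::euclidean_space \<Rightarrow> 'b::real_vector"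
  assumes "linear L"
  shows "L v = (\<Sum>i\<in>Basis. (v \<bullet> i) *\<^sub>R L i)"
proof -
  have "L v = L (\<Sum>i\<in>Basis. (v \<bullet> i) *\<^sub>R i)" by (simp add: euclidean_representation)
  also have "\<dots> = (\<Sum>i\<in>Basis. (v \<bullet> i) *\<^sub>R L i)"
    using assms by (simp add: linear_sum linear_cmul)
  finally show ?thesis .
qed

text \<open>The chain rule evaluates the derivative of \<open>f\<close> in the moving direction
  \<open>?G x v\<close>. Expanded over the basis, it becomes a sum of products in which the
  induction hypothesis handles the compositions of \<open>g\<close> with the partial derivatives of
  \<open>f\<close>.\<close>

lemma Ck_on_compose:
  fixes g :: "'a::euclidean_space \<Rightarrow> 'b::euclidean_space"
  assumes "open S" "open T" "g ` S \<subseteq> T"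
  shows "Ck_on k T f \<Longrightarrow> Ck_on k S g \<Longrightarrow> Ck_on k S (\<lambda>x. f (g x))"
proof (induction k arbitrary: f)
  case 0
  then show ?case using assms by (simp add: continuous_on_compose2)
next
  case (Suc k)
  let ?F = "\<lambda>y. frechet_derivative f (at y)" and ?G = "\<lambda>x. frechet_derivative g (at x)"
  have F: "(f has_derivative ?F (g x)) (at (g x))" if "x \<in> S" for x
    using that assms(3) by (intro Ck_on_has_derivative[OF Suc.prems(1)]) auto
  have G: "(g has_derivative ?G x) (at x)" if "x \<in> S" for x
    using that by (intro Ck_on_has_derivative[OF Suc.prems(2)])
  show ?case
  proof (rule Ck_on_SucI[OF assms(1)])
    fix x assume x: "x \<in> S"
    have lin: "linear (?F (g x))" using F[OF x] has_derivative_linear by blast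
    have "((\<lambda>x. f (g x)) has_derivative (\<lambda>v. ?F (g x) (?G x v))) (at x)"
      using diff_chain_at[OF G[OF x] F[OF x]] by (simp add: o_def)
    then show "((\<lambda>x. f (g x)) has_derivative (\<lambda>v. \<Sum>i\<in>Basis. (?G x v \<bullet> i) *\<^sub>R ?F (g x) i)) (at x)"
      by (simp flip: linear_expand_Basis[OF lin])
  next
    fix v
    show "Ck_on k S (\<lambda>x. \<Sum>i\<in>Basis. (?G x v \<bullet> i) *\<^sub>R ?F (g x) i)"
      using Suc.prems
      by (intro Ck_on_sum Ck_on_scaleR Ck_on_inner Ck_on_const assms(1) Suc.IH
          Ck_on_deriv[OF Suc.prems(1)] Ck_on_deriv[OF Suc.prems(2)] Ck_on_SucD[OF Suc.prems(2)])
  qed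
qed

text \<open>A bootstrap for solutions of autonomous differential equations: the last assumption says
  that \<open>h'\<close> composed with \<open>f\<close> is as regular as \<open>h\<close> composed
  with \<open>f\<close> and \<open>f\<close> itself, which holds when \<open>h'\<close> is a
  polynomial in \<open>h\<close>, as for exp and inverse, or involves known smooth factors, as for
  sqrt.\<close>

lemma Ck_on_realfun:
  fixes h :: "real \<Rightarrow> real" and f :: "'a::euclidean_space \<Rightarrow> real"
  assumes "open S" "open T" "\<And>x. x \<in> T \<Longrightarrow> (h has_real_derivative h' x) (at x)"
    "\<And>x. x \<in> S \<Longrightarrow> f x \<in> T"
    and "\<And>k. Ck_on k S (\<lambda>x. h (f x)) \<Longrightarrow> Ck_on k S f \<Longrightarrow> Ck_on k S (\<lambda>x. h' (f x))"
  shows "Ck_on k S f \<Longrightarrow> Ck_on k S (\<lambda>x. h (f x))"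
proof (induction k)
  case 0
  have "continuous_on T h"
    using assms(2,3) by (meson DERIV_continuous continuous_at_imp_continuous_on)
  then show ?case using 0 assms(4) by (auto intro: continuous_on_compose2)
next
  case (Suc k)
  show ?case
  proof (rule Ck_on_SucI[OF assms(1)])
    fix x assume x: "x \<in> S"
    have "(h has_derivative (*) (h' (f x))) (at (f x))"
      using assms(3,4) x by (simp add: has_field_derivative_def)
    from diff_chain_at[OF Ck_on_has_derivative[OF Suc.prems x] this]
    show "((\<lambda>x. h (f x)) has_derivative (\<lambda>v. h' (f x) * frechet_derivative f (at x) v)) (at x)"
      by (simp add: o_def)
  next
    fix v
    show "Ck_on k S (\<lambda>x. h' (f x) * frechet_derivative f (at x) v)"
      by (intro Ck_on_mult assms(1) assms(5) Suc.IH Ck_on_deriv[OF Suc.prems] Ck_on_SucD[OF Suc.prems])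
  qed
qed

section \<open>Smooth functions: algebra, composition, exp, inverse and sqrt\<close>

lemma smooth_on_imp_Ck: "smooth_on S f \<Longrightarrow> Ck_on k S f"
  by (simp add: smooth_on_def)

lemma smooth_on_has_derivative:
  "smooth_on S f \<Longrightarrow> x \<in> S \<Longrightarrow> (f has_derivative frechet_derivative f (at x)) (at x)"
  by (metis Ck_on_has_derivative smooth_on_def)

lemma smooth_on_continuous: "smooth_on S f \<Longrightarrow> continuous_on S f"
  by (metis Ck_on_continuous smooth_on_def)

lemma smooth_on_deriv: "smooth_on S f \<Longrightarrow> smooth_on S (\<lambda>x. frechet_derivative f (at x) v)"
  by (metis Ck_on_deriv smooth_on_def)

lemma smooth_onI:
  assumes "open S" "\<And>x. x \<in> S \<Longrightarrow> (f has_derivative F x) (at x)"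
    "\<And>v. smooth_on S (\<lambda>x. F x v)"
  shows "smooth_on S f"
  unfolding smooth_on_def
proof
  fix k
  have "Ck_on (Suc k) S f"
    using assms by (intro Ck_on_SucI) (auto simp: smooth_on_def)
  then show "Ck_on k S f" by (rule Ck_on_SucD)
qed

lemma smooth_on_subset: "smooth_on S f \<Longrightarrow> T \<subseteq> S \<Longrightarrow> smooth_on T f"
  by (auto simp: smooth_on_def intro: Ck_on_subset)

lemma smooth_on_cong:
  "open S \<Longrightarrow> (\<And>x. x \<in> S \<Longrightarrow> f x = g x) \<Longrightarrow> smooth_on S f \<Longrightarrow> smooth_on S g"
  by (auto simp: smooth_on_def intro: Ck_on_cong)

lemma smooth_on_const: "open S \<Longrightarrow> smooth_on S (\<lambda>x. c)"
  by (simp add: smooth_on_def Ck_on_const)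

lemma smooth_on_bounded_linear: "open S \<Longrightarrow> bounded_linear L \<Longrightarrow> smooth_on S L"
  by (simp add: smooth_on_def Ck_on_bounded_linear)

lemma smooth_on_add:
  "open S \<Longrightarrow> smooth_on S f \<Longrightarrow> smooth_on S g \<Longrightarrow> smooth_on S (\<lambda>x. f x + g x)"
  by (simp add: smooth_on_def Ck_on_add)

lemma smooth_on_scaleR:
  "open S \<Longrightarrow> smooth_on S f \<Longrightarrow> smooth_on S g \<Longrightarrow> smooth_on S (\<lambda>x. f x *\<^sub>R g x)"
  by (simp add: smooth_on_def Ck_on_scaleR)

lemma smooth_on_inner:
  "open S \<Longrightarrow> smooth_on S f \<Longrightarrow> smooth_on S g \<Longrightarrow> smooth_on S (\<lambda>x. f x \<bullet> g x)"
  by (simp add: smooth_on_def Ck_on_inner)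

lemma smooth_on_mult:
  fixes f g :: "'a::euclidean_space \<Rightarrow> real"
  shows "open S \<Longrightarrow> smooth_on S f \<Longrightarrow> smooth_on S g \<Longrightarrow> smooth_on S (\<lambda>x. f x * g x)"
  by (simp add: smooth_on_def Ck_on_mult)

lemma smooth_on_compose:
  fixes g :: "'a::euclidean_space \<Rightarrow> 'b::euclidean_space"
  shows "open S \<Longrightarrow> open T \<Longrightarrow> g ` S \<subseteq> T \<Longrightarrow> smooth_on T f \<Longrightarrow> smooth_on S g
    \<Longrightarrow> smooth_on S (\<lambda>x. f (g x))"
  by (simp add: smooth_on_def Ck_on_compose)

lemma smooth_on_minus: "open S \<Longrightarrow> smooth_on S f \<Longrightarrow> smooth_on S (\<lambda>x. - f x)"
  using smooth_on_scaleR[of S "\<lambda>x. -1" f] by (simp add: smooth_on_const)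

lemma smooth_on_diff:
  "open S \<Longrightarrow> smooth_on S f \<Longrightarrow> smooth_on S g \<Longrightarrow> smooth_on S (\<lambda>x. f x - g x)"
  using smooth_on_add[of S f "\<lambda>x. - g x"] by (simp add: smooth_on_minus)

lemma smooth_on_linear_compose:
  fixes f :: "'a::euclidean_space \<Rightarrow> 'b::euclidean_space"
  shows "open S \<Longrightarrow> bounded_linear L \<Longrightarrow> smooth_on S f \<Longrightarrow> smooth_on S (\<lambda>x. L (f x))"
  using smooth_on_compose[of S UNIV f L] smooth_on_bounded_linear[of UNIV L] by simp

lemma smooth_on_exp:
  fixes f :: "'a::euclidean_space \<Rightarrow> real"
  assumes S: "open S" and sm: "smooth_on S f"
  shows "smooth_on S (\<lambda>x. exp (f x))"
  unfolding smooth_on_def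
proof
  fix k
  show "Ck_on k S (\<lambda>x. exp (f x))"
    by (rule Ck_on_realfun[where h=exp and h'=exp and T=UNIV and f=f,
          OF S open_UNIV DERIV_exp UNIV_I _ smooth_on_imp_Ck[OF sm]])
qed

lemma smooth_on_inverse:
  fixes f :: "'a::euclidean_space \<Rightarrow> real"
  assumes S: "open S" and nz: "\<And>x. x \<in> S \<Longrightarrow> f x \<noteq> 0" and sm: "smooth_on S f"
  shows "smooth_on S (\<lambda>x. inverse (f x))"
  unfolding smooth_on_def
proof
  fix k
  have der: "(inverse has_real_derivative -1 * (inverse x * inverse x)) (at x)"
    if "x \<in> - {0}" for x :: real
    using that DERIV_inverse[of x UNIV] by (simp add: power2_eq_square)
  show "Ck_on k S (\<lambda>x. inverse (f x))"
  proof (rule Ck_on_realfun[where h=inverse and T="-{0}" and f=f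
        and h'="\<lambda>x. -1 * (inverse x * inverse x)", OF S _ der])
    fix k assume "Ck_on k S (\<lambda>x. inverse (f x))"
    then show "Ck_on k S (\<lambda>x. -1 * (inverse (f x) * inverse (f x)))"
      by (intro Ck_on_mult[OF S] Ck_on_const[OF S])
  qed (use nz smooth_on_imp_Ck[OF sm] in auto)
qed

lemma smooth_on_sqrt:
  fixes f :: "'a::euclidean_space \<Rightarrow> real"
  assumes S: "open S" and pos: "\<And>x. x \<in> S \<Longrightarrow> f x > 0" and sm: "smooth_on S f"
  shows "smooth_on S (\<lambda>x. sqrt (f x))"
  unfolding smooth_on_def
proof
  fix k
  have inv: "smooth_on S (\<lambda>x. inverse (f x))"
    by (rule smooth_on_inverse[OF S _ sm]) (use pos in force)
  have der: "(sqrt has_real_derivative 1/2 * (inverse x * sqrt x)) (at x)"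
    if "x \<in> {0<..}" for x :: real
  proof -
    \<comment> \<open>The derivative is rewritten so that sqrt itself reappears, multiplied by the
      already smooth inverse; this is the shape the bootstrap needs.\<close>
    have "inverse (sqrt x) = inverse x * sqrt x"
      using that by (simp add: field_simps)
    with that show ?thesis
      using DERIV_real_sqrt[of x] by (simp add: mult.commute)
  qed
  show "Ck_on k S (\<lambda>x. sqrt (f x))"
  proof (rule Ck_on_realfun[where h=sqrt and T="{0<..}" and f=f
        and h'="\<lambda>x. 1/2 * (inverse x * sqrt x)", OF S _ der])
    fix k assume "Ck_on k S (\<lambda>x. sqrt (f x))"
    then show "Ck_on k S (\<lambda>x. 1/2 * (inverse (f x) * sqrt (f x)))"
      by (intro Ck_on_mult[OF S] Ck_on_const[OF S] smooth_on_imp_Ck[OF inv])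
  qed (use pos smooth_on_imp_Ck[OF sm] in auto)
qed

text \<open>If \<open>g\<close> is of class C^k, so is the right-hand side of its derivative, hence
  \<open>g\<close> is of class C^(k+1). It serves for the inverse of a coordinate map: there
  \<open>m\<close> and \<open>n\<close> are the dual coframe of the target, and \<open>A\<close>,
  \<open>B\<close> the frame of the source.\<close>

lemma smooth_on_frame_ode:
  fixes g :: "'a::euclidean_space \<Rightarrow> 'b::euclidean_space"
  assumes V: "open V" "open S" "g ` V \<subseteq> S"
    and A: "smooth_on S A" and B: "smooth_on S B"
    and m: "\<And>v. smooth_on V (\<lambda>y. m y v)" and n: "\<And>v. smooth_on V (\<lambda>y. n y v)"
    and der: "\<And>y. y \<in> V \<Longrightarrow> (g has_derivative (\<lambda>v. m y v *\<^sub>R A (g y) + n y v *\<^sub>R B (g y))) (at y)"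
  shows "smooth_on V g"
  unfolding smooth_on_def
proof
  fix k
  show "Ck_on k V g"
  proof (induction k)
    case 0
    then show ?case using der
      by (auto intro!: continuous_at_imp_continuous_on dest: has_derivative_continuous)
  next
    case (Suc k)
    note AB = A[THEN smooth_on_imp_Ck, THEN Ck_on_compose[OF V], OF Suc]
      B[THEN smooth_on_imp_Ck, THEN Ck_on_compose[OF V], OF Suc]
    show ?case
      by (rule Ck_on_SucI[OF V(1) der], assumption)
        (intro Ck_on_add[OF V(1)] Ck_on_scaleR[OF V(1)] smooth_on_imp_Ck[OF m] smooth_on_imp_Ck[OF n] AB)
  qed
qed

section \<open>Symmetry of second derivatives\<close>

lemma has_derivative_along_line:
  assumes "(f has_derivative F) (at (x + s *\<^sub>R u))"
  shows "((\<lambda>s. f (x + s *\<^sub>R u)) has_vector_derivative F u) (at s)"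
proof -
  have "((\<lambda>s. x + s *\<^sub>R u) has_derivative (\<lambda>h. h *\<^sub>R u)) (at s)"
    by (auto intro!: derivative_eq_intros)
  from diff_chain_at[OF this assms]
  have "((\<lambda>s. f (x + s *\<^sub>R u)) has_derivative (\<lambda>h. F (h *\<^sub>R u))) (at s)"
    by (simp add: o_def)
  moreover have "F (h *\<^sub>R u) = h *\<^sub>R F u" for h
    using assms has_derivative_linear linear_cmul by blast
  ultimately show ?thesis by (simp add: has_vector_derivative_def)
qed

text \<open>Two mean value steps over a parallelogram: the difference in the direction
  \<open>v\<close> is treated as a function of the \<open>u\<close> parameter, and the resulting
  increment of the first derivative is then resolved along \<open>v\<close>. The left-hand side is
  symmetric in \<open>u\<close> and \<open>v\<close>, which is what makes the formula
  useful.\<close>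

lemma second_difference_mvt:
  fixes g :: "'a::euclidean_space \<Rightarrow> real"
  assumes g: "Ck_on 2 S g" and s: "s > 0"
    and mem: "\<And>a b. 0 \<le> a \<Longrightarrow> a \<le> s \<Longrightarrow> 0 \<le> b \<Longrightarrow> b \<le> s \<Longrightarrow> x + a *\<^sub>R u + b *\<^sub>R v \<in> S"
  obtains a b where "0 < a" "a < s" "0 < b" "b < s"
    "g (x + s *\<^sub>R u + s *\<^sub>R v) - g (x + s *\<^sub>R u) - g (x + s *\<^sub>R v) + g x
      = s * s * frechet_derivative (\<lambda>y. frechet_derivative g (at y) u) (at (x + a *\<^sub>R u + b *\<^sub>R v)) v"
proof -
  let ?P = "\<lambda>y. frechet_derivative g (at y) u"
  have g2: "Ck_on (Suc (Suc 0)) S g" using g by (simp add: numeral_2_eq_2)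
  note gd = Ck_on_has_derivative[OF g2]
  note Pd = Ck_on_has_derivative[OF Ck_on_deriv[OF g2]]
  have 1: "((\<lambda>a. g (x + a *\<^sub>R u + b *\<^sub>R v)) has_real_derivative ?P (x + a *\<^sub>R u + b *\<^sub>R v)) (at a)"
    if "0 \<le> a" "a \<le> s" "0 \<le> b" "b \<le> s" for a b
    using has_derivative_along_line[where x="x + b *\<^sub>R v" and s=a and u=u, OF gd] mem[OF that]
    by (simp add: has_real_derivative_iff_has_vector_derivative algebra_simps)
  have 2: "((\<lambda>b. ?P (x + a *\<^sub>R u + b *\<^sub>R v)) has_real_derivative
      frechet_derivative ?P (at (x + a *\<^sub>R u + b *\<^sub>R v)) v) (at b)"
    if "0 \<le> a" "a \<le> s" "0 \<le> b" "b \<le> s" for a b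
    using has_derivative_along_line[where x="x + a *\<^sub>R u" and s=b and u=v, OF Pd] mem[OF that]
    by (simp add: has_real_derivative_iff_has_vector_derivative)
  have "\<exists>a>0. a < s \<and>
      (g (x + s *\<^sub>R u + s *\<^sub>R v) - g (x + s *\<^sub>R u + 0 *\<^sub>R v)) -
      (g (x + 0 *\<^sub>R u + s *\<^sub>R v) - g (x + 0 *\<^sub>R u + 0 *\<^sub>R v))
      = (s - 0) * (?P (x + a *\<^sub>R u + s *\<^sub>R v) - ?P (x + a *\<^sub>R u + 0 *\<^sub>R v))"
    by (rule MVT2[OF s]) (intro DERIV_diff 1; use s in simp)
  then obtain a where a: "0 < a" "a < s" and
    eqa: "g (x + s *\<^sub>R u + s *\<^sub>R v) - g (x + s *\<^sub>R u) - g (x + s *\<^sub>R v) + g x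
      = s * (?P (x + a *\<^sub>R u + s *\<^sub>R v) - ?P (x + a *\<^sub>R u + 0 *\<^sub>R v))"
    by auto
  have "\<exists>b>0. b < s \<and> ?P (x + a *\<^sub>R u + s *\<^sub>R v) - ?P (x + a *\<^sub>R u + 0 *\<^sub>R v)
      = (s - 0) * frechet_derivative ?P (at (x + a *\<^sub>R u + b *\<^sub>R v)) v"
    by (rule MVT2[OF s]) (rule 2; use a in simp)
  then obtain b where "0 < b" "b < s" and "?P (x + a *\<^sub>R u + s *\<^sub>R v) - ?P (x + a *\<^sub>R u + 0 *\<^sub>R v)
      = s * frechet_derivative ?P (at (x + a *\<^sub>R u + b *\<^sub>R v)) v"
    by auto
  with a eqa show ?thesis by (intro that[of a b]) auto
qed

text \<open>The same second difference equals \<open>s * s\<close> times either mixed derivative at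
  some intermediate point. If the two values at \<open>x\<close> differed, continuity would keep
  them apart on a small enough parallelogram.\<close>

lemma symmetric_second_derivative_real:
  fixes g :: "'a::euclidean_space \<Rightarrow> real"
  assumes S: "open S" "x \<in> S" and g: "Ck_on 2 S g"
  shows "frechet_derivative (\<lambda>y. frechet_derivative g (at y) u) (at x) v
       = frechet_derivative (\<lambda>y. frechet_derivative g (at y) v) (at x) u"
proof (rule ccontr)
  let ?P = "\<lambda>y. frechet_derivative (\<lambda>y. frechet_derivative g (at y) u) (at y) v"
  let ?Q = "\<lambda>y. frechet_derivative (\<lambda>y. frechet_derivative g (at y) v) (at y) u"
  assume ne: "?P x \<noteq> ?Q x"
  \<comment> \<open>Half the gap, so that the open intervals of radius \<open>e\<close> around the
    two values are disjoint.\<close>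
  define e where "e = \<bar>?P x - ?Q x\<bar> / 2"
  have e: "e > 0" using ne by (simp add: e_def)
  have "continuous_on S ?P" "continuous_on S ?Q"
    using g by (simp_all add: numeral_2_eq_2)
  then have "isCont ?P x" "isCont ?Q x"
    using S by (simp_all add: continuous_on_eq_continuous_at)
  then obtain d1 d2 where d: "d1 > 0" "\<And>y. dist y x < d1 \<Longrightarrow> \<bar>?P y - ?P x\<bar> < e"
      "d2 > 0" "\<And>y. dist y x < d2 \<Longrightarrow> \<bar>?Q y - ?Q x\<bar> < e"
    unfolding continuous_at_eps_delta dist_real_def using e by metis
  obtain r where r: "r > 0" "ball x r \<subseteq> S" using S open_contains_ball by blast
  define m where "m = min r (min d1 d2)"
  \<comment> \<open>Scaled so that the whole parallelogram lies within distance \<open>m\<close> of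
    \<open>x\<close>; the added 1 covers the case where both directions vanish.\<close>
  define s where "s = m / (norm u + norm v + 1)"
  have m: "m > 0" using d r by (simp add: m_def)
  have nn: "norm u + norm v + 1 > 0" by (simp add: add_nonneg_pos)
  have s: "s > 0" using m nn by (simp add: s_def)
  have near: "dist (x + a *\<^sub>R u + b *\<^sub>R v) x < m" if "0 \<le> a" "a \<le> s" "0 \<le> b" "b \<le> s" for a b
  proof -
    have "dist (x + a *\<^sub>R u + b *\<^sub>R v) x = norm (a *\<^sub>R u + b *\<^sub>R v)"
      by (simp add: dist_norm)
    also have "\<dots> \<le> a * norm u + b * norm v"
      using norm_triangle_ineq[of "a *\<^sub>R u" "b *\<^sub>R v"] that by simp
    also have "\<dots> \<le> s * norm u + s * norm v"
      using that by (intro add_mono mult_right_mono) auto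
    also have "\<dots> < s * (norm u + norm v + 1)" using s by (simp add: algebra_simps)
    also have "\<dots> = m" using nn by (simp add: s_def)
    finally show ?thesis .
  qed
  have mem: "x + a *\<^sub>R u + b *\<^sub>R v \<in> S" if "0 \<le> a" "a \<le> s" "0 \<le> b" "b \<le> s" for a b
    using near[OF that] r by (auto simp: m_def dist_commute)
  obtain a b where ab: "0 < a" "a < s" "0 < b" "b < s"
    and P: "g (x + s *\<^sub>R u + s *\<^sub>R v) - g (x + s *\<^sub>R u) - g (x + s *\<^sub>R v) + g x
      = s * s * ?P (x + a *\<^sub>R u + b *\<^sub>R v)"
    using second_difference_mvt[OF g s mem] by blast
  have mem': "x + a *\<^sub>R v + b *\<^sub>R u \<in> S" if "0 \<le> a" "a \<le> s" "0 \<le> b" "b \<le> s" for a b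
    using mem[of b a] that by (simp add: algebra_simps)
  obtain a' b' where ab': "0 < a'" "a' < s" "0 < b'" "b' < s"
    and Q: "g (x + s *\<^sub>R v + s *\<^sub>R u) - g (x + s *\<^sub>R v) - g (x + s *\<^sub>R u) + g x
      = s * s * ?Q (x + a' *\<^sub>R v + b' *\<^sub>R u)"
    using second_difference_mvt[OF g s mem'] by blast
  have "s * s * ?P (x + a *\<^sub>R u + b *\<^sub>R v) = s * s * ?Q (x + a' *\<^sub>R v + b' *\<^sub>R u)"
    using P Q by (simp add: algebra_simps)
  then have "?P (x + a *\<^sub>R u + b *\<^sub>R v) = ?Q (x + b' *\<^sub>R u + a' *\<^sub>R v)"
    using s by (simp add: algebra_simps)
  moreover have "\<bar>?P (x + a *\<^sub>R u + b *\<^sub>R v) - ?P x\<bar> < e"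
    by (rule d) (use near[of a b] ab in \<open>auto simp: m_def\<close>)
  moreover have "\<bar>?Q (x + b' *\<^sub>R u + a' *\<^sub>R v) - ?Q x\<bar> < e"
    by (rule d) (use near[of b' a'] ab' in \<open>auto simp: m_def\<close>)
  ultimately show False unfolding e_def by (simp add: abs_if split: if_splits)
qed

lemma symmetric_second_derivative:
  fixes f :: "'a::euclidean_space \<Rightarrow> 'b::euclidean_space"
  assumes S: "open S" "x \<in> S" and f: "smooth_on S f"
  shows "frechet_derivative (\<lambda>y. frechet_derivative f (at y) u) (at x) v
       = frechet_derivative (\<lambda>y. frechet_derivative f (at y) v) (at x) u"
proof (rule euclidean_eqI)
  fix w :: 'b
  let ?g = "\<lambda>y. f y \<bullet> w"
  have g: "smooth_on S ?g"
    by (rule smooth_on_linear_compose[OF S(1) bounded_linear_inner_left f])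
  have D: "frechet_derivative (\<lambda>y. h y \<bullet> w) (at y) z = frechet_derivative h (at y) z \<bullet> w"
    if "smooth_on S h" "y \<in> S" for y z and h :: "'a \<Rightarrow> 'b"
    using has_derivative_inner_left[OF smooth_on_has_derivative[OF that], of w]
      frechet_derivative_at by metis
  have D2: "frechet_derivative (\<lambda>y. frechet_derivative ?g (at y) u) (at x) v =
     frechet_derivative (\<lambda>y. frechet_derivative f (at y) u) (at x) v \<bullet> w" for u v
  proof -
    have h: "smooth_on S (\<lambda>y. frechet_derivative f (at y) u)" by (rule smooth_on_deriv[OF f])
    have "((\<lambda>y. frechet_derivative f (at y) u \<bullet> w) has_derivative
        (\<lambda>z. frechet_derivative (\<lambda>y. frechet_derivative f (at y) u) (at x) z \<bullet> w)) (at x)"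
      by (rule has_derivative_inner_left[OF smooth_on_has_derivative[OF h S(2)]])
    then have "((\<lambda>y. frechet_derivative ?g (at y) u) has_derivative
        (\<lambda>z. frechet_derivative (\<lambda>y. frechet_derivative f (at y) u) (at x) z \<bullet> w)) (at x)"
      by (rule has_derivative_transform_within_open[OF _ S]) (simp add: D[OF f])
    from frechet_derivative_at[OF this] show ?thesis by metis
  qed
  show "frechet_derivative (\<lambda>y. frechet_derivative f (at y) u) (at x) v \<bullet> w
      = frechet_derivative (\<lambda>y. frechet_derivative f (at y) v) (at x) u \<bullet> w"
    using symmetric_second_derivative_real[OF S smooth_on_imp_Ck[OF g], of u v] by (simp only: D2)
qed

section \<open>Closed one-forms, frames and coframes\<close>

text \<open>The Poincare lemma, with one-forms encoded as vector fields through the inner product.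
  The primitive is the integral of the form along the segment from a base point; differentiating
  under the integral sign and using closedness turns the integrand into a total derivative in the
  parameter.\<close>

lemma closed_form_exact:
  fixes w :: "'a::euclidean_space \<Rightarrow> 'a"
  assumes S: "open S" "convex S" and w: "smooth_on S w"
    and closed: "\<And>x u v. x \<in> S \<Longrightarrow>
      frechet_derivative w (at x) u \<bullet> v = frechet_derivative w (at x) v \<bullet> u"
  obtains h where "\<And>x. x \<in> S \<Longrightarrow> (h has_derivative (\<lambda>v. w x \<bullet> v)) (at x)"
proof (cases "S = {}")
  case True
  then show ?thesis using that by blast
next
  case False
  then obtain p where p: "p \<in> S" by blast
  let ?D = "\<lambda>y. frechet_derivative w (at y)"
  define c where "c x t = p + t *\<^sub>R (x - p)" for x :: 'a and t :: real
  \<comment> \<open>This is the derivative of \<open>t *\<^sub>R w (c x t)\<close> in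
    \<open>t\<close>, and also, by closedness, the gradient of the integrand in
    \<open>x\<close>.\<close>
  define Z where "Z x t = t *\<^sub>R ?D (c x t) (x - p) + w (c x t)" for x t
  have c: "c x t \<in> S" if "x \<in> S" "t \<in> {0..1}" for x t
  proof -
    have "c x t = (1 - t) *\<^sub>R p + t *\<^sub>R x" by (simp add: c_def algebra_simps)
    then show ?thesis using convexD[OF S(2) p that(1), of "1 - t" t] that(2) by simp
  qed
  note wd = smooth_on_has_derivative[OF w]
  have lin: "linear (?D (c x t))" if "x \<in> S" "t \<in> {0..1}" for x t
    using wd[OF c[OF that]] has_derivative_linear by blast
  let ?h = "\<lambda>x. integral (cbox 0 1) (\<lambda>t. w (c x t) \<bullet> (x - p))"
  have contw: "continuous_on S w" using w by (rule smooth_on_continuous)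
  have contD: "continuous_on S (\<lambda>y. ?D y i)" for i
    by (rule smooth_on_continuous[OF smooth_on_deriv[OF w]])
  have contc: "continuous_on (S \<times> cbox 0 1) (\<lambda>z. c (fst z) (snd z))"
    unfolding c_def by (intro continuous_intros)
  have csub: "(\<lambda>z. c (fst z) (snd z)) ` (S \<times> cbox 0 1) \<subseteq> S" using c by auto
  \<comment> \<open>Differentiation under the integral sign asks for joint continuity of
    \<open>Z\<close>. The direction \<open>x - p\<close> moves with the point, so the derivative is
    first expanded over the basis.\<close>
  have contsum: "continuous_on (S \<times> cbox 0 1)
    (\<lambda>z. snd z *\<^sub>R (\<Sum>i\<in>Basis. ((fst z - p) \<bullet> i) *\<^sub>R ?D (c (fst z) (snd z)) i) + w (c (fst z) (snd z)))"
    by (intro continuous_intros continuous_on_compose2[OF contw contc csub]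
        continuous_on_compose2[OF contD contc csub])
  have Zsum: "Z (fst z) (snd z) = snd z *\<^sub>R (\<Sum>i\<in>Basis. ((fst z - p) \<bullet> i) *\<^sub>R ?D (c (fst z) (snd z)) i)
      + w (c (fst z) (snd z))" if "z \<in> S \<times> cbox 0 1" for z
    unfolding Z_def using that
    by (subst linear_expand_Basis[OF lin]) auto
  have contZ: "continuous_on (S \<times> cbox 0 1) (\<lambda>z. Z (fst z) (snd z))"
    by (rule continuous_on_eq[OF contsum Zsum[symmetric]])
  have der: "(?h has_derivative integral (cbox 0 1) (\<lambda>t. blinfun_inner_right (Z x t))) (at x within S)"
    if x: "x \<in> S" for x
  proof (rule leibniz_rule[OF _ _ _ x S(2)])
    fix y t assume y: "y \<in> S" and t: "t \<in> cbox 0 (1::real)"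
    then have t': "t \<in> {0..1}" by simp
    have "((\<lambda>y. c y t) has_derivative (\<lambda>v. t *\<^sub>R v)) (at y within S)"
      unfolding c_def by (auto intro!: derivative_eq_intros)
    then have "((\<lambda>y. w (c y t)) has_derivative (\<lambda>v. ?D (c y t) (t *\<^sub>R v))) (at y within S)"
      using has_derivative_compose wd[OF c[OF y t']] by blast
    then have "((\<lambda>y. w (c y t) \<bullet> (y - p)) has_derivative
        (\<lambda>v. w (c y t) \<bullet> (v - 0) + ?D (c y t) (t *\<^sub>R v) \<bullet> (y - p))) (at y within S)"
      by (intro has_derivative_inner derivative_intros)
    \<comment> \<open>Closedness is used here, to exchange \<open>v\<close> and
      \<open>y - p\<close>.\<close>
    moreover have "w (c y t) \<bullet> (v - 0) + ?D (c y t) (t *\<^sub>R v) \<bullet> (y - p) = blinfun_inner_right (Z y t) v" for v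
      using closed[OF c[OF y t'], of v "y - p"] linear_cmul[OF lin[OF y t'], of t v]
      by (simp add: Z_def inner_add_left)
    ultimately show "((\<lambda>y. w (c y t) \<bullet> (y - p)) has_derivative blinfun_inner_right (Z y t)) (at y within S)"
      by simp
  next
    fix y assume y: "y \<in> S"
    have "continuous_on {0..1} (\<lambda>t. w (c y t))"
      by (rule continuous_on_compose2[OF contw]) (use c y in \<open>auto simp: c_def intro!: continuous_intros\<close>)
    then show "(\<lambda>t. w (c y t) \<bullet> (y - p)) integrable_on cbox 0 1"
      by (intro integrable_continuous continuous_intros) simp
  next
    show "continuous_on (S \<times> cbox 0 1) (\<lambda>(x, t). blinfun_inner_right (Z x t))"
      unfolding case_prod_beta
      by (rule bounded_linear.continuous_on[OF bounded_linear_blinfun_inner_right contZ])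
  qed
  have int: "integral (cbox 0 1) (\<lambda>t. blinfun_inner_right (Z x t)) = blinfun_inner_right (w x)"
    if x: "x \<in> S" for x
  proof -
    \<comment> \<open>Boundary values of the total derivative: at \<open>t = 1\<close> the form at
      \<open>x\<close>, at \<open>t = 0\<close> nothing, because of the factor
      \<open>t\<close>.\<close>
    have "((\<lambda>t. blinfun_inner_right (Z x t)) has_integral
        blinfun_inner_right (1 *\<^sub>R w (c x 1)) - blinfun_inner_right (0 *\<^sub>R w (c x 0))) {0..1}"
    proof (rule fundamental_theorem_of_calculus)
      fix t :: real assume t: "t \<in> {0..1}"
      have "((\<lambda>t. w (c x t)) has_vector_derivative ?D (c x t) (x - p)) (at t)"
        unfolding c_def by (rule has_derivative_along_line, rule wd) (use c[OF x t] in \<open>simp add: c_def\<close>)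
      then have "((\<lambda>t. w (c x t)) has_vector_derivative ?D (c x t) (x - p)) (at t within {0..1})"
        by (rule has_vector_derivative_at_within)
      then have "((\<lambda>t. t *\<^sub>R w (c x t)) has_vector_derivative Z x t) (at t within {0..1})"
        unfolding Z_def by (auto intro!: derivative_eq_intros)
      then show "((\<lambda>t. blinfun_inner_right (t *\<^sub>R w (c x t))) has_vector_derivative
          blinfun_inner_right (Z x t)) (at t within {0..1})"
        by (rule bounded_linear.has_vector_derivative[OF bounded_linear_blinfun_inner_right])
    qed simp
    moreover have "blinfun_inner_right (0::'a) = 0" by (rule blinfun_eqI) simp
    ultimately show ?thesis by (simp add: c_def integral_unique)
  qed
  have "(?h has_derivative (\<lambda>v. w x \<bullet> v)) (at x)" if "x \<in> S" for x
    using der[OF that] unfolding int[OF that] at_within_open[OF that S(1)] blinfun_inner_right.rep_eq .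
  then show ?thesis by (rule that)
qed

text \<open>The one-forms are again vectors acting by the inner product. The last clause says that
  \<open>A\<close> and \<open>B\<close> span at each point, so the dimension two enters only through
  it.\<close>

definition coframe :: "'a::euclidean_space set \<Rightarrow> ('a \<Rightarrow> 'a) \<Rightarrow> ('a \<Rightarrow> 'a) \<Rightarrow> ('a \<Rightarrow> 'a) \<Rightarrow> ('a \<Rightarrow> 'a) \<Rightarrow> bool" where
  "coframe S A B \<alpha> \<beta> \<longleftrightarrow> open S \<and>
     smooth_on S A \<and> smooth_on S B \<and> smooth_on S \<alpha> \<and> smooth_on S \<beta> \<and>
     (\<forall>x\<in>S. \<alpha> x \<bullet> A x = 1 \<and> \<alpha> x \<bullet> B x = 0 \<and> \<beta> x \<bullet> A x = 0 \<and> \<beta> x \<bullet> B x = 1 \<and>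
        (\<forall>v. v = (\<alpha> x \<bullet> v) *\<^sub>R A x + (\<beta> x \<bullet> v) *\<^sub>R B x))"

lemma coframeD:
  assumes "coframe S A B \<alpha> \<beta>"
  shows "open S" "smooth_on S A" "smooth_on S B" "smooth_on S \<alpha>" "smooth_on S \<beta>"
    "x \<in> S \<Longrightarrow> \<alpha> x \<bullet> A x = 1" "x \<in> S \<Longrightarrow> \<alpha> x \<bullet> B x = 0" "x \<in> S \<Longrightarrow> \<beta> x \<bullet> A x = 0" "x \<in> S \<Longrightarrow> \<beta> x \<bullet> B x = 1"
    "x \<in> S \<Longrightarrow> v = (\<alpha> x \<bullet> v) *\<^sub>R A x + (\<beta> x \<bullet> v) *\<^sub>R B x"
  using assms unfolding coframe_def by blast+

lemma coframe_subset: "coframe S A B \<alpha> \<beta> \<Longrightarrow> T \<subseteq> S \<Longrightarrow> open T \<Longrightarrow> coframe T A B \<alpha> \<beta>"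
  unfolding coframe_def by (blast intro: smooth_on_subset)

definition bracket :: "('a::euclidean_space \<Rightarrow> 'a) \<Rightarrow> ('a \<Rightarrow> 'a) \<Rightarrow> 'a \<Rightarrow> 'a" where
  "bracket A B x = frechet_derivative B (at x) (A x) - frechet_derivative A (at x) (B x)"

text \<open>\<open>d\<theta>(A, B)\<close>\<close>

definition exterior :: "('a::euclidean_space \<Rightarrow> 'a) \<Rightarrow> ('a \<Rightarrow> 'a) \<Rightarrow> ('a \<Rightarrow> 'a) \<Rightarrow> 'a \<Rightarrow> real" where
  "exterior \<theta> A B x = frechet_derivative \<theta> (at x) (A x) \<bullet> B x - frechet_derivative \<theta> (at x) (B x) \<bullet> A x"

text \<open>The product rule for a constant pairing moves the derivative from the form to the field
  at the price of a sign.\<close>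

lemma derivative_constant_pairing:
  fixes \<theta> X :: "'a::euclidean_space \<Rightarrow> 'a"
  assumes "open S" "x \<in> S" "smooth_on S \<theta>" "smooth_on S X" "\<And>y. y \<in> S \<Longrightarrow> \<theta> y \<bullet> X y = c"
  shows "frechet_derivative \<theta> (at x) u \<bullet> X x = - (\<theta> x \<bullet> frechet_derivative X (at x) u)"
proof -
  have "((\<lambda>y. \<theta> y \<bullet> X y) has_derivative
      (\<lambda>u. \<theta> x \<bullet> frechet_derivative X (at x) u + frechet_derivative \<theta> (at x) u \<bullet> X x)) (at x)"
    using assms(2-4) by (intro has_derivative_inner smooth_on_has_derivative)
  moreover have "((\<lambda>y. \<theta> y \<bullet> X y) has_derivative (\<lambda>u. 0)) (at x)"
    by (rule has_derivative_transform_within_open[OF has_derivative_const assms(1,2)]) (simp add: assms(5))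
  ultimately have "(\<lambda>u. \<theta> x \<bullet> frechet_derivative X (at x) u + frechet_derivative \<theta> (at x) u \<bullet> X x) = (\<lambda>u. 0)"
    by (rule has_derivative_unique)
  from fun_cong[OF this, of u] show ?thesis by simp
qed

text \<open>Cartan's formula d\<theta>(A, B) = A(\<theta>(B)) - B(\<theta>(A)) - \<theta>([A, B]),
  in which the first two terms vanish because the pairings are constant.\<close>

lemma exterior_dual:
  fixes \<theta> :: "'a::euclidean_space \<Rightarrow> 'a"
  assumes "open S" "x \<in> S" "smooth_on S \<theta>" "smooth_on S A" "smooth_on S B"
    "\<And>y. y \<in> S \<Longrightarrow> \<theta> y \<bullet> A y = c" "\<And>y. y \<in> S \<Longrightarrow> \<theta> y \<bullet> B y = d"
  shows "exterior \<theta> A B x = - (\<theta> x \<bullet> bracket A B x)"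
  using derivative_constant_pairing[OF assms(1-4,6), of "B x"]
    derivative_constant_pairing[OF assms(1-3,5,7), of "A x"]
  by (simp add: exterior_def bracket_def inner_diff_right)

text \<open>The rule d(k \<theta>) = k d\<theta> + dk \<and> \<theta>, evaluated on the pair (A,
  B).\<close>

lemma exterior_scaled:
  fixes \<theta> :: "'a::euclidean_space \<Rightarrow> 'a"
  assumes "open S" "x \<in> S" "smooth_on S \<theta>" "(k has_derivative k') (at x)"
  shows "exterior (\<lambda>y. k y *\<^sub>R \<theta> y) A B x
    = k x * exterior \<theta> A B x + k' (A x) * (\<theta> x \<bullet> B x) - k' (B x) * (\<theta> x \<bullet> A x)"
proof -
  have "((\<lambda>y. k y *\<^sub>R \<theta> y) has_derivative (\<lambda>u. k x *\<^sub>R frechet_derivative \<theta> (at x) u + k' u *\<^sub>R \<theta> x)) (at x)"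
    using assms by (intro has_derivative_scaleR smooth_on_has_derivative)
  from frechet_derivative_at[OF this, symmetric] show ?thesis
    by (simp add: exterior_def inner_add_left algebra_simps)
qed

lemma exterior_add:
  fixes \<theta> \<eta> :: "'a::euclidean_space \<Rightarrow> 'a"
  assumes "x \<in> S" "smooth_on S \<theta>" "smooth_on S \<eta>"
  shows "exterior (\<lambda>y. \<theta> y + \<eta> y) A B x = exterior \<theta> A B x + exterior \<eta> A B x"
proof -
  have "((\<lambda>y. \<theta> y + \<eta> y) has_derivative
      (\<lambda>u. frechet_derivative \<theta> (at x) u + frechet_derivative \<eta> (at x) u)) (at x)"
    using assms by (intro has_derivative_add smooth_on_has_derivative)
  from frechet_derivative_at[OF this, symmetric] show ?thesis
    by (simp add: exterior_def inner_add_left)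
qed

text \<open>The derivative of the form is bilinear in the two directions and the frame spans, so its
  antisymmetric part vanishes as soon as it does on (A, B). The Poincare lemma then applies.\<close>

lemma coframe_potential:
  fixes \<theta> :: "'a::euclidean_space \<Rightarrow> 'a"
  assumes co: "coframe S A B \<alpha> \<beta>" and S: "convex S" and \<theta>: "smooth_on S \<theta>"
    and ext: "\<And>x. x \<in> S \<Longrightarrow> exterior \<theta> A B x = 0"
  obtains h where "smooth_on S h" "\<And>x. x \<in> S \<Longrightarrow> (h has_derivative (\<lambda>v. \<theta> x \<bullet> v)) (at x)"
proof -
  note oS = coframeD(1)[OF co]
  have "frechet_derivative \<theta> (at x) u \<bullet> v = frechet_derivative \<theta> (at x) v \<bullet> u" if x: "x \<in> S" for x u v
  proof -
    let ?L = "frechet_derivative \<theta> (at x)"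
    have lin: "linear ?L" using smooth_on_has_derivative[OF \<theta> x] has_derivative_linear by blast
    note lin' = linear_add[OF lin] linear_cmul[OF lin]
    obtain a b where u: "u = a *\<^sub>R A x + b *\<^sub>R B x" using coframeD(10)[OF co x] by blast
    obtain c d where v: "v = c *\<^sub>R A x + d *\<^sub>R B x" using coframeD(10)[OF co x] by blast
    have "?L (A x) \<bullet> B x = ?L (B x) \<bullet> A x" using ext[OF x] by (simp add: exterior_def)
    then show ?thesis unfolding u v lin' by (simp add: inner_add_left inner_add_right algebra_simps)
  qed
  from closed_form_exact[OF oS S \<theta> this] obtain h
    where h: "\<And>x. x \<in> S \<Longrightarrow> (h has_derivative (\<lambda>v. \<theta> x \<bullet> v)) (at x)" by blast
  have "smooth_on S h"
    by (rule smooth_onI[OF oS h]) (auto intro!: smooth_on_inner[OF oS \<theta>] smooth_on_const[OF oS])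
  then show ?thesis using h by (rule that)
qed

text \<open>A map that carries a frame to a frame has invertible derivative, so the inverse function
  theorem applies. The inverse map carries the frames back, and this first-order equation gives its
  smoothness through \<open>smooth_on_frame_ode\<close>.\<close>

lemma frame_inverse_function:
  fixes \<phi> :: "'a::euclidean_space \<Rightarrow> 'a"
  assumes co: "coframe S A B \<alpha> \<beta>" and co': "coframe T A' B' \<alpha>' \<beta>'"
    and \<phi>: "smooth_on S \<phi>" "\<phi> ` S \<subseteq> T" and p: "p \<in> S"
    and dA: "\<And>x. x \<in> S \<Longrightarrow> frechet_derivative \<phi> (at x) (A x) = A' (\<phi> x)"
    and dB: "\<And>x. x \<in> S \<Longrightarrow> frechet_derivative \<phi> (at x) (B x) = B' (\<phi> x)"
  obtains U V \<psi> where "open U" "p \<in> U" "U \<subseteq> S" "open V" "V \<subseteq> T" "homeomorphism U V \<phi> \<psi>" "smooth_on V \<psi>"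
proof -
  define f' where "f' x = Blinfun (frechet_derivative \<phi> (at x))" for x
  have bl: "bounded_linear (frechet_derivative \<phi> (at x))" if "x \<in> S" for x
    using smooth_on_has_derivative[OF \<phi>(1) that] has_derivative_bounded_linear by blast
  have f': "blinfun_apply (f' x) = frechet_derivative \<phi> (at x)" if "x \<in> S" for x
    using bl[OF that] by (simp add: f'_def bounded_linear_Blinfun_apply)
  have cont: "continuous_on S f'"
  proof (rule continuous_on_blinfun_componentwise)
    fix i :: 'a
    have "continuous_on S (\<lambda>x. frechet_derivative \<phi> (at x) i)"
      by (rule smooth_on_continuous[OF smooth_on_deriv[OF \<phi>(1)]])
    then show "continuous_on S (\<lambda>x. f' x i)"
      by (rule continuous_on_eq) (simp add: f')
  qed
  have \<phi>p: "\<phi> p \<in> T" using \<phi>(2) p by blast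
  \<comment> \<open>The left inverse of the derivative at \<open>p\<close>: read off the components
    in the target frame and attach them to the source frame.\<close>
  define L where "L w = (\<alpha>' (\<phi> p) \<bullet> w) *\<^sub>R A p + (\<beta>' (\<phi> p) \<bullet> w) *\<^sub>R B p" for w
  have L: "bounded_linear L"
    unfolding L_def by (intro bounded_linear_add bounded_linear_scaleR_const bounded_linear_inner_right)
  have lin: "linear (frechet_derivative \<phi> (at p))" using bl[OF p] by (simp add: bounded_linear.linear)
  have "L (frechet_derivative \<phi> (at p) v) = v" for v
  proof -
    have "frechet_derivative \<phi> (at p) v = (\<alpha> p \<bullet> v) *\<^sub>R A' (\<phi> p) + (\<beta> p \<bullet> v) *\<^sub>R B' (\<phi> p)"
      by (subst coframeD(10)[OF co p, of v]) (simp only: linear_add[OF lin] linear_cmul[OF lin] dA[OF p] dB[OF p])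
    then have "L (frechet_derivative \<phi> (at p) v) = (\<alpha> p \<bullet> v) *\<^sub>R A p + (\<beta> p \<bullet> v) *\<^sub>R B p"
      by (simp add: L_def inner_add_right coframeD(6-9)[OF co' \<phi>p])
    then show ?thesis using coframeD(10)[OF co p, of v] by simp
  qed
  then have inv: "Blinfun L o\<^sub>L f' p = id_blinfun"
    by (intro blinfun_eqI) (simp add: bounded_linear_Blinfun_apply[OF L] f'[OF p])
  obtain U V g g' where U: "open U" "U \<subseteq> S" "p \<in> U" "open V" "\<phi> p \<in> V" and hom: "homeomorphism U V \<phi> g"
    and g: "\<And>y. y \<in> V \<Longrightarrow> (g has_derivative (g' y)) (at y)"
    and g': "\<And>y. y \<in> V \<Longrightarrow> g' y = inv (blinfun_apply (f' (g y)))"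
    and bij: "\<And>y. y \<in> V \<Longrightarrow> bij (blinfun_apply (f' (g y)))"
    using inverse_function_theorem[OF coframeD(1)[OF co] _ cont p inv]
      smooth_on_has_derivative[OF \<phi>(1)] f' by metis
  have gU: "g y \<in> U" "\<phi> (g y) = y" if "y \<in> V" for y
    using hom that by (auto simp: homeomorphism_def)
  have VT: "V \<subseteq> T" using hom U(2) \<phi>(2) by (auto simp: homeomorphism_def)
  have "smooth_on V g"
  proof (rule smooth_on_frame_ode[OF U(4) U(1) _ smooth_on_subset[OF coframeD(2)[OF co] U(2)]
        smooth_on_subset[OF coframeD(3)[OF co] U(2)]])
    show "g ` V \<subseteq> U" using gU by auto
    show "smooth_on V (\<lambda>y. \<alpha>' y \<bullet> v)" "smooth_on V (\<lambda>y. \<beta>' y \<bullet> v)" for v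
      using coframeD(4,5)[OF co'] VT U(4) by (auto intro!: smooth_on_inner smooth_on_const intro: smooth_on_subset)
    fix y assume y: "y \<in> V"
    have gS: "g y \<in> S" and yT: "y \<in> T" using gU[OF y] U(2) VT y by auto
    have "g' y (A' y) = A (g y)" "g' y (B' y) = B (g y)"
      using dA[OF gS] dB[OF gS] gU[OF y] bij[OF y] by (simp_all add: g'[OF y] f'[OF gS] inv_f_eq bij_is_inj)
    moreover have "linear (g' y)" using g[OF y] has_derivative_linear by blast
    ultimately have "g' y v = (\<alpha>' y \<bullet> v) *\<^sub>R A (g y) + (\<beta>' y \<bullet> v) *\<^sub>R B (g y)" for v
      by (subst coframeD(10)[OF co' yT, of v]) (simp only: linear_add linear_cmul)
    then show "(g has_derivative (\<lambda>v. (\<alpha>' y \<bullet> v) *\<^sub>R A (g y) + (\<beta>' y \<bullet> v) *\<^sub>R B (g y))) (at y)"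
      using g[OF y] by (metis (no_types, lifting) ext)
  qed
  then show ?thesis using that U hom VT by blast
qed

section \<open>Normal forms for frames of the plane with constant structure coefficients\<close>

text \<open>Product rule for a derivative applied to a varying direction. Symmetry of the second
  derivative turns the second-order term into one that differentiates along \<open>X x\<close>, so
  that the terms arising from two fields can later be cancelled.\<close>

lemma has_derivative_apply_field:
  fixes f :: "'a::euclidean_space \<Rightarrow> 'b::euclidean_space" and X :: "'a \<Rightarrow> 'a"
  assumes S: "open S" "x \<in> S" and f: "smooth_on S f" and X: "smooth_on S X"
  shows "((\<lambda>y. frechet_derivative f (at y) (X y)) has_derivative
    (\<lambda>v. frechet_derivative f (at x) (frechet_derivative X (at x) v)
       + frechet_derivative (\<lambda>y. frechet_derivative f (at y) v) (at x) (X x))) (at x)"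
proof -
  let ?F = "\<lambda>y. frechet_derivative f (at y)" and ?H = "\<lambda>u. frechet_derivative (\<lambda>y. frechet_derivative f (at y) u) (at x)"
  have lin: "linear (?F y)" if "y \<in> S" for y
    using smooth_on_has_derivative[OF f that] has_derivative_linear by blast
  have linH: "linear (?H v)" for v
    using smooth_on_has_derivative[OF smooth_on_deriv[OF f] S(2)] has_derivative_linear by blast
  have "((\<lambda>y. \<Sum>i\<in>Basis. (X y \<bullet> i) *\<^sub>R ?F y i) has_derivative
     (\<lambda>v. \<Sum>i\<in>Basis. (X x \<bullet> i) *\<^sub>R ?H i v + (frechet_derivative X (at x) v \<bullet> i) *\<^sub>R ?F x i)) (at x)"
    by (intro has_derivative_sum has_derivative_scaleR has_derivative_inner_left
        smooth_on_has_derivative[OF X S(2)] smooth_on_has_derivative[OF smooth_on_deriv[OF f] S(2)])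
  moreover have "(\<Sum>i\<in>Basis. (X x \<bullet> i) *\<^sub>R ?H i v + (frechet_derivative X (at x) v \<bullet> i) *\<^sub>R ?F x i)
      = ?F x (frechet_derivative X (at x) v) + ?H v (X x)" for v
  proof -
    have "(\<Sum>i\<in>Basis. (X x \<bullet> i) *\<^sub>R ?H i v) = ?H v (X x)"
      using linear_expand_Basis[OF linH, of v "X x"]
      by (simp only: symmetric_second_derivative[OF S f, of _ v])
    moreover have "(\<Sum>i\<in>Basis. (frechet_derivative X (at x) v \<bullet> i) *\<^sub>R ?F x i)
        = ?F x (frechet_derivative X (at x) v)"
      by (rule linear_expand_Basis[OF lin[OF S(2)], symmetric])
    ultimately show ?thesis by (simp add: sum.distrib)
  qed
  ultimately have "((\<lambda>y. \<Sum>i\<in>Basis. (X y \<bullet> i) *\<^sub>R ?F y i) has_derivative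
     (\<lambda>v. ?F x (frechet_derivative X (at x) v) + ?H v (X x))) (at x)"
    by simp
  then show ?thesis
    by (rule has_derivative_transform_within_open[OF _ S]) (rule linear_expand_Basis[OF lin, symmetric])
qed

text \<open>Naturality of the Lie bracket: the relation for \<open>A\<close> is differentiated along
  \<open>B\<close>, the relation for \<open>B\<close> along \<open>A\<close>, and the second-order
  terms of \<open>f\<close> cancel in the difference. The factor \<epsilon> is constant on
  \<open>S\<close>, so no derivative of it appears.\<close>

lemma bracket_related:
  fixes f :: "'a::euclidean_space \<Rightarrow> 'a"
  assumes S: "open S" "x \<in> S" and f: "smooth_on S f" "f ` S \<subseteq> T"
    and AB: "smooth_on S A" "smooth_on S B" and AB': "smooth_on T A'" "smooth_on T B'"
    and A: "\<And>y. y \<in> S \<Longrightarrow> frechet_derivative f (at y) (A y) = A' (f y)"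
    and B: "\<And>y. y \<in> S \<Longrightarrow> frechet_derivative f (at y) (B y) = \<epsilon> *\<^sub>R B' (f y)"
  shows "frechet_derivative f (at x) (bracket A B x) = \<epsilon> *\<^sub>R bracket A' B' (f x)"
proof -
  let ?F = "frechet_derivative f (at x)" and ?H = "\<lambda>u. frechet_derivative (\<lambda>y. frechet_derivative f (at y) u) (at x)"
  have fx: "f x \<in> T" using S f by blast
  note fd = smooth_on_has_derivative[OF f(1) S(2)]
  have lin: "linear ?F" using fd has_derivative_linear by blast
  have "((\<lambda>y. A' (f y)) has_derivative (\<lambda>v. frechet_derivative A' (at (f x)) (?F v))) (at x)"
    using diff_chain_at[OF fd smooth_on_has_derivative[OF AB'(1) fx]] by (simp add: o_def)
  then have "((\<lambda>y. frechet_derivative f (at y) (A y)) has_derivative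
      (\<lambda>v. frechet_derivative A' (at (f x)) (?F v))) (at x)"
    by (rule has_derivative_transform_within_open[OF _ S]) (simp add: A)
  from fun_cong[OF has_derivative_unique[OF has_derivative_apply_field[OF S f(1) AB(1)] this], of "B x"]
  have 1: "?F (frechet_derivative A (at x) (B x)) + ?H (B x) (A x)
      = frechet_derivative A' (at (f x)) (\<epsilon> *\<^sub>R B' (f x))" by (simp add: B[OF S(2)])
  have "((\<lambda>y. \<epsilon> *\<^sub>R B' (f y)) has_derivative (\<lambda>v. \<epsilon> *\<^sub>R frechet_derivative B' (at (f x)) (?F v))) (at x)"
    using diff_chain_at[OF fd smooth_on_has_derivative[OF AB'(2) fx]]
    by (intro has_derivative_scaleR_right) (simp add: o_def)
  then have "((\<lambda>y. frechet_derivative f (at y) (B y)) has_derivative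
      (\<lambda>v. \<epsilon> *\<^sub>R frechet_derivative B' (at (f x)) (?F v))) (at x)"
    by (rule has_derivative_transform_within_open[OF _ S]) (simp add: B)
  from fun_cong[OF has_derivative_unique[OF has_derivative_apply_field[OF S f(1) AB(2)] this], of "A x"]
  have 2: "?F (frechet_derivative B (at x) (A x)) + ?H (A x) (B x)
      = \<epsilon> *\<^sub>R frechet_derivative B' (at (f x)) (A' (f x))" by (simp add: A[OF S(2)])
  have "linear (frechet_derivative A' (at (f x)))"
    using smooth_on_has_derivative[OF AB'(1) fx] has_derivative_linear by blast
  then have 3: "frechet_derivative A' (at (f x)) (\<epsilon> *\<^sub>R B' (f x)) = \<epsilon> *\<^sub>R frechet_derivative A' (at (f x)) (B' (f x))"
    by (rule linear_cmul)
  have "?F (bracket A B x) = ?F (frechet_derivative B (at x) (A x)) - ?F (frechet_derivative A (at x) (B x))"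
    by (simp add: bracket_def linear_diff[OF lin])
  also have "\<dots> = (?F (frechet_derivative B (at x) (A x)) + ?H (A x) (B x))
      - (?F (frechet_derivative A (at x) (B x)) + ?H (B x) (A x))"
    using symmetric_second_derivative[OF S f(1), of "A x" "B x"] by simp
  also have "\<dots> = \<epsilon> *\<^sub>R bracket A' B' (f x)"
    unfolding 1 2 3 by (simp add: bracket_def scaleR_diff_right)
  finally show ?thesis .
qed

lemma smooth_on_component: "open S \<Longrightarrow> smooth_on S X \<Longrightarrow> smooth_on S (\<lambda>x. (X x :: real^'n) $ i)"
  by (rule smooth_on_linear_compose[OF _ bounded_linear_vec_nth])

text \<open>Cramer's rule: the dual coframe is the inverse of the matrix with columns
  \<open>A x\<close> and \<open>B x\<close>, whose determinant is \<open>d x\<close>.\<close>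

lemma coframe_exists:
  fixes A B :: "real^2 \<Rightarrow> real^2"
  assumes S: "open S" and sm: "smooth_on S A" "smooth_on S B"
    and ind: "\<And>x a b. x \<in> S \<Longrightarrow> a *\<^sub>R A x + b *\<^sub>R B x = 0 \<Longrightarrow> a = 0 \<and> b = 0"
  obtains \<alpha> \<beta> where "coframe S A B \<alpha> \<beta>"
proof -
  define d where "d x = A x $ 1 * B x $ 2 - A x $ 2 * B x $ 1" for x
  have d: "d x \<noteq> 0" if x: "x \<in> S" for x
  proof
    assume "d x = 0"
    \<comment> \<open>A vanishing determinant yields these two relations; independence makes all
      their coefficients zero, so \<open>A x\<close> would vanish, which independence
      excludes.\<close>
    then have "(B x $ 2) *\<^sub>R A x + (- A x $ 2) *\<^sub>R B x = 0" "(B x $ 1) *\<^sub>R A x + (- A x $ 1) *\<^sub>R B x = 0"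
      by (simp_all add: vec_eq_iff forall_2 d_def algebra_simps)
    from this[THEN ind[OF x]] have "1 *\<^sub>R A x + 0 *\<^sub>R B x = 0"
      by (simp add: vec_eq_iff forall_2)
    from ind[OF x this] show False by simp
  qed
  define \<alpha> where "\<alpha> x = inverse (d x) *\<^sub>R ((B x $ 2) *\<^sub>R axis 1 1 - (B x $ 1) *\<^sub>R axis 2 1 :: real^2)" for x
  define \<beta> where "\<beta> x = inverse (d x) *\<^sub>R ((A x $ 1) *\<^sub>R axis 2 1 - (A x $ 2) *\<^sub>R axis 1 1 :: real^2)" for x
  note smooth = smooth_on_component[OF S] smooth_on_scaleR[OF S] smooth_on_const[OF S]
    smooth_on_diff[OF S] smooth_on_mult[OF S] sm
  have "smooth_on S d" unfolding d_def by (intro smooth)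
  then have i: "smooth_on S (\<lambda>x. inverse (d x))" using d by (intro smooth_on_inverse S)
  have "smooth_on S \<alpha>" "smooth_on S \<beta>" unfolding \<alpha>_def \<beta>_def by (intro smooth i)+
  moreover have "\<alpha> x \<bullet> A x = 1" "\<alpha> x \<bullet> B x = 0" "\<beta> x \<bullet> A x = 0" "\<beta> x \<bullet> B x = 1"
    "v = (\<alpha> x \<bullet> v) *\<^sub>R A x + (\<beta> x \<bullet> v) *\<^sub>R B x" if "x \<in> S" for x v
  proof -
    have a: "\<alpha> x $ 1 = inverse (d x) * B x $ 2" "\<alpha> x $ 2 = - inverse (d x) * B x $ 1"
      "\<beta> x $ 1 = - inverse (d x) * A x $ 2" "\<beta> x $ 2 = inverse (d x) * A x $ 1"
      by (simp_all add: \<alpha>_def \<beta>_def axis_def)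
    have e: "inverse (d x) * A x $ 1 * B x $ 2 - inverse (d x) * A x $ 2 * B x $ 1 = 1"
    proof -
      have "inverse (d x) * (A x $ 1 * B x $ 2 - A x $ 2 * B x $ 1) = 1"
        using d[OF that] by (simp flip: d_def)
      then show ?thesis by (simp add: algebra_simps)
    qed
    show "\<alpha> x \<bullet> A x = 1" "\<alpha> x \<bullet> B x = 0" "\<beta> x \<bullet> A x = 0" "\<beta> x \<bullet> B x = 1"
      using e by (simp_all add: inner_vec_def sum_2 a algebra_simps)
    have "(\<alpha> x \<bullet> v) * A x $ i + (\<beta> x \<bullet> v) * B x $ i = inverse (d x) * (v $ i * d x)" for i
      using exhaust_2[of i] by (auto simp: inner_vec_def sum_2 a d_def[of x] algebra_simps)
    then show "v = (\<alpha> x \<bullet> v) *\<^sub>R A x + (\<beta> x \<bullet> v) *\<^sub>R B x"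
      using d[OF that] by (simp add: vec_eq_iff)
  qed
  ultimately show ?thesis using S sm that unfolding coframe_def by blast
qed

lemma plane_map:
  fixes g h :: "real^2 \<Rightarrow> real"
  assumes S: "open S" and sm: "smooth_on S g" "smooth_on S h"
  defines "\<phi> \<equiv> \<lambda>x. g x *\<^sub>R axis 1 1 + h x *\<^sub>R axis 2 1 :: real^2"
  shows "smooth_on S \<phi>" "\<phi> x $ 1 = g x" "\<phi> x $ 2 = h x"
    and "(g has_derivative g') (at x) \<Longrightarrow> (h has_derivative h') (at x) \<Longrightarrow>
      frechet_derivative \<phi> (at x) v = g' v *\<^sub>R axis 1 1 + h' v *\<^sub>R axis 2 1"
proof -
  show "smooth_on S \<phi>" unfolding \<phi>_def
    by (intro smooth_on_add[OF S] smooth_on_scaleR[OF S] smooth_on_const[OF S] sm)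
  show "\<phi> x $ 1 = g x" "\<phi> x $ 2 = h x" by (simp_all add: \<phi>_def axis_def)
  assume "(g has_derivative g') (at x)" "(h has_derivative h') (at x)"
  then have "(\<phi> has_derivative (\<lambda>v. g' v *\<^sub>R axis 1 1 + h' v *\<^sub>R axis 2 1)) (at x)"
    unfolding \<phi>_def by (intro has_derivative_add has_derivative_scaleR_left)
  from frechet_derivative_at[OF this, symmetric]
  show "frechet_derivative \<phi> (at x) v = g' v *\<^sub>R axis 1 1 + h' v *\<^sub>R axis 2 1" by simp
qed

text \<open>Here d\<alpha> = 0, so \<alpha> = dg. On (A, B) the form d\<beta> takes the value -b,
  and the factor exp(b g) contributes +b relative to itself, so exp(b g) \<beta> is closed. Its
  primitive \<open>h\<close> is the second coordinate.\<close>

lemma normal_form_bracket_tangent: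
  fixes A B :: "real^2 \<Rightarrow> real^2"
  assumes co: "coframe S A B \<alpha> \<beta>" and S: "convex S" and p: "p \<in> S"
    and br: "\<And>x. x \<in> S \<Longrightarrow> bracket A B x = b *\<^sub>R B x"
  obtains U V and \<phi> \<psi> :: "real^2 \<Rightarrow> real^2" where "open U" "p \<in> U" "U \<subseteq> S" "open V" "homeomorphism U V \<phi> \<psi>"
    "smooth_on U \<phi>" "smooth_on V \<psi>"
    "\<And>x. x \<in> U \<Longrightarrow> frechet_derivative \<phi> (at x) (A x) = axis 1 1"
    "\<And>x. x \<in> U \<Longrightarrow> frechet_derivative \<phi> (at x) (B x) = exp (b * \<phi> x $ 1) *\<^sub>R axis 2 1"
proof -
  note oS = coframeD(1)[OF co] and c = coframeD(2-5)[OF co] and d = coframeD(6-9)[OF co]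
  have "exterior \<alpha> A B x = 0" if "x \<in> S" for x
    using exterior_dual[OF oS that c(3) c(1,2) d(1,2)] by (simp add: br[OF that] d[OF that])
  from coframe_potential[OF co S c(3) this] obtain g where g: "smooth_on S g"
    "\<And>x. x \<in> S \<Longrightarrow> (g has_derivative (\<lambda>v. \<alpha> x \<bullet> v)) (at x)" by blast
  have k: "((\<lambda>y. exp (b * g y)) has_derivative (\<lambda>v. exp (b * g x) * (b * (\<alpha> x \<bullet> v)))) (at x)"
    if "x \<in> S" for x
    using g(2)[OF that] by (auto intro!: derivative_eq_intros)
  have "exterior (\<lambda>y. exp (b * g y) *\<^sub>R \<beta> y) A B x = 0" if "x \<in> S" for x
    using exterior_dual[OF oS that c(4) c(1,2) d(3,4)]
    by (simp add: exterior_scaled[OF oS that c(4) k[OF that]] br[OF that] d[OF that])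
  moreover have "smooth_on S (\<lambda>y. exp (b * g y) *\<^sub>R \<beta> y)"
    by (intro smooth_on_scaleR smooth_on_exp smooth_on_mult smooth_on_const oS g c)
  ultimately obtain h where h: "smooth_on S h"
    "\<And>x. x \<in> S \<Longrightarrow> (h has_derivative (\<lambda>v. (exp (b * g x) *\<^sub>R \<beta> x) \<bullet> v)) (at x)"
    using coframe_potential[OF co S] by blast
  define \<phi> :: "real^2 \<Rightarrow> real^2" where "\<phi> x = g x *\<^sub>R axis 1 1 + h x *\<^sub>R axis 2 1" for x
  note \<phi> = plane_map[OF oS g(1) h(1), folded \<phi>_def]
  have dA: "frechet_derivative \<phi> (at x) (A x) = axis 1 1"
    and dB: "frechet_derivative \<phi> (at x) (B x) = exp (b * \<phi> x $ 1) *\<^sub>R axis 2 1" if "x \<in> S" for x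
    using \<phi>(4)[OF g(2) h(2)] that by (simp_all add: \<phi>(2) d[OF that])
  have e: "smooth_on UNIV (\<lambda>x::real^2. exp (c * x $ 1))" for c
    by (intro smooth_on_exp smooth_on_mult smooth_on_const smooth_on_bounded_linear
        bounded_linear_vec_nth open_UNIV)
  \<comment> \<open>The target frame with its dual, written in the new coordinates; it supplies the
    second coframe for the inverse function argument.\<close>
  have "coframe UNIV (\<lambda>x::real^2. axis 1 1) (\<lambda>x. exp (b * x $ 1) *\<^sub>R axis 2 1)
     (\<lambda>x. axis 1 1) (\<lambda>x. exp (- b * x $ 1) *\<^sub>R axis 2 1)"
    unfolding coframe_def
    by (intro conjI open_UNIV smooth_on_scaleR smooth_on_const e)
      (auto simp: vec_eq_iff forall_2 inner_vec_def sum_2 axis_def simp flip: exp_add)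
  from frame_inverse_function[OF co this \<phi>(1) _ p dA dB] obtain U V \<psi>
    where UV: "open U" "p \<in> U" "U \<subseteq> S" "open V" "homeomorphism U V \<phi> \<psi>" "smooth_on V \<psi>" by auto
  show ?thesis
    by (rule that[OF UV(1-5) smooth_on_subset[OF \<phi>(1) UV(3)] UV(6)]) (use dA dB UV(3) in auto)
qed

text \<open>On (A, B) the forms d\<alpha> and d\<beta> take the values 1 and -b, so b \<alpha> +
  \<beta> is closed, with primitive \<open>z\<close>. Since this form is 1 on \<open>B\<close>, the
  factor exp z contributes -exp z, which cancels exp z d\<alpha>. Taking exp z rather than
  \<open>z\<close> as second coordinate makes both fields linear in it and places the image in the
  upper half-plane.\<close>

lemma normal_form_bracket_transverse:
  fixes A B :: "real^2 \<Rightarrow> real^2"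
  assumes co: "coframe S A B \<alpha> \<beta>" and S: "convex S" and p: "p \<in> S"
    and br: "\<And>x. x \<in> S \<Longrightarrow> bracket A B x = b *\<^sub>R B x - A x"
  obtains U V and \<phi> \<psi> :: "real^2 \<Rightarrow> real^2" where "open U" "p \<in> U" "U \<subseteq> S" "open V" "V \<subseteq> {y. y $ 2 > 0}" "homeomorphism U V \<phi> \<psi>"
    "smooth_on U \<phi>" "smooth_on V \<psi>"
    "\<And>x. x \<in> U \<Longrightarrow> frechet_derivative \<phi> (at x) (A x) = \<phi> x $ 2 *\<^sub>R (axis 1 1 + b *\<^sub>R axis 2 1)"
    "\<And>x. x \<in> U \<Longrightarrow> frechet_derivative \<phi> (at x) (B x) = \<phi> x $ 2 *\<^sub>R axis 2 1"
proof -
  note oS = coframeD(1)[OF co] and c = coframeD(2-5)[OF co] and d = coframeD(6-9)[OF co]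
  have ext: "exterior \<alpha> A B x = 1" "exterior \<beta> A B x = - b" if "x \<in> S" for x
    using exterior_dual[OF oS that c(3) c(1,2) d(1,2)] exterior_dual[OF oS that c(4) c(1,2) d(3,4)]
    by (simp_all add: br[OF that] d[OF that] inner_diff_right)
  define \<theta> where "\<theta> y = b *\<^sub>R \<alpha> y + \<beta> y" for y
  have b\<alpha>: "smooth_on S (\<lambda>y. b *\<^sub>R \<alpha> y)" by (intro smooth_on_scaleR smooth_on_const oS c)
  have \<theta>: "smooth_on S \<theta>" unfolding \<theta>_def by (intro smooth_on_add oS b\<alpha> c)
  have "exterior \<theta> A B x = 0" if "x \<in> S" for x
    using exterior_scaled[OF oS that c(3) has_derivative_const, of b A B] ext[OF that]
    by (simp add: \<theta>_def[abs_def] exterior_add[OF that b\<alpha> c(4)])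
  from coframe_potential[OF co S \<theta> this] obtain z where z: "smooth_on S z"
    "\<And>x. x \<in> S \<Longrightarrow> (z has_derivative (\<lambda>v. \<theta> x \<bullet> v)) (at x)" by blast
  have k: "((\<lambda>y. exp (z y)) has_derivative (\<lambda>v. exp (z x) * (\<theta> x \<bullet> v))) (at x)"
    if "x \<in> S" for x
    using z(2)[OF that] by (auto intro!: derivative_eq_intros)
  have sk: "smooth_on S (\<lambda>y. exp (z y))" by (intro smooth_on_exp oS z)
  have "exterior (\<lambda>y. exp (z y) *\<^sub>R \<alpha> y) A B x = 0" if "x \<in> S" for x
    by (simp add: exterior_scaled[OF oS that c(3) k[OF that]] ext[OF that] d[OF that] \<theta>_def inner_add_left)
  moreover have "smooth_on S (\<lambda>y. exp (z y) *\<^sub>R \<alpha> y)"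
    by (intro smooth_on_scaleR sk oS c)
  ultimately obtain g where g: "smooth_on S g"
    "\<And>x. x \<in> S \<Longrightarrow> (g has_derivative (\<lambda>v. (exp (z x) *\<^sub>R \<alpha> x) \<bullet> v)) (at x)"
    using coframe_potential[OF co S] by blast
  define \<phi> :: "real^2 \<Rightarrow> real^2" where "\<phi> x = g x *\<^sub>R axis 1 1 + exp (z x) *\<^sub>R axis 2 1" for x
  note \<phi> = plane_map[OF oS g(1) sk, folded \<phi>_def]
  have dA: "frechet_derivative \<phi> (at x) (A x) = \<phi> x $ 2 *\<^sub>R (axis 1 1 + b *\<^sub>R axis 2 1)"
    and dB: "frechet_derivative \<phi> (at x) (B x) = \<phi> x $ 2 *\<^sub>R axis 2 1" if "x \<in> S" for x
    using \<phi>(4)[OF g(2) k] that by (simp_all add: \<phi>(3) d[OF that] \<theta>_def inner_add_left scaleR_add_right)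
  define T where "T = {y::real^2. y $ 2 > 0}"
  have T: "open T" unfolding T_def by (intro open_Collect_less continuous_intros)
  have y: "smooth_on T (\<lambda>y. y $ 2)" by (rule smooth_on_bounded_linear[OF T bounded_linear_vec_nth])
  then have iy: "smooth_on T (\<lambda>y. inverse (y $ 2))" by (rule smooth_on_inverse[OF T, rotated]) (auto simp: T_def)
  have co': "coframe T (\<lambda>y. y $ 2 *\<^sub>R (axis 1 1 + b *\<^sub>R axis 2 1)) (\<lambda>y. y $ 2 *\<^sub>R axis 2 1)
     (\<lambda>y. inverse (y $ 2) *\<^sub>R axis 1 1) (\<lambda>y. inverse (y $ 2) *\<^sub>R (axis 2 1 - b *\<^sub>R axis 1 1))"
    unfolding coframe_def
    by (intro conjI T smooth_on_scaleR smooth_on_const y iy)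
      (auto simp: T_def vec_eq_iff forall_2 inner_vec_def sum_2 axis_def field_simps)
  have "\<phi> ` S \<subseteq> T" by (auto simp: T_def \<phi>(3))
  from frame_inverse_function[OF co co' \<phi>(1) this p dA dB] obtain U V \<psi>
    where UV: "open U" "p \<in> U" "U \<subseteq> S" "open V" "V \<subseteq> T" "homeomorphism U V \<phi> \<psi>" "smooth_on V \<psi>"
    by blast
  show ?thesis
    by (rule that[OF UV(1-4) UV(5)[unfolded T_def] UV(6) smooth_on_subset[OF \<phi>(1) UV(3)] UV(7)])
      (use dA dB UV(3) in auto)
qed

section \<open>Charts and tangent vectors\<close>

lemma chart_homeomorphic:
  assumes "smooth_manifold M" "c \<in> atlas M"
  shows "openin (topo M) (fst c)" "open (snd c ` fst c)"
    "homeomorphic_map (subtopology (topo M) (fst c)) (top_of_set (snd c ` fst c)) (snd c)"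
  using assms unfolding smooth_manifold_def by blast+

lemma chart_topspace:
  assumes "smooth_manifold M" "c \<in> atlas M"
  shows "fst c \<subseteq> points M" "topspace (subtopology (topo M) (fst c)) = fst c"
  using openin_subset[OF chart_homeomorphic(1)[OF assms]] by auto

lemma chart_inj_on:
  assumes "smooth_manifold M" "c \<in> atlas M"
  shows "inj_on (snd c) (fst c)"
  using homeomorphic_imp_injective_map[OF chart_homeomorphic(3)[OF assms]] chart_topspace(2)[OF assms] by simp

lemma chart_inv_chart:
  assumes "smooth_manifold M" "c \<in> atlas M" "x \<in> fst c"
  shows "chart_inv c (snd c x) = x"
  using chart_inj_on[OF assms(1,2)] assms(3) by simp

lemma chart_open_image:
  assumes "smooth_manifold M" "c \<in> atlas M" "openin (topo M) W"
  shows "open (snd c ` (fst c \<inter> W))"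
proof -
  have "openin (subtopology (topo M) (fst c)) (fst c \<inter> W)"
    using assms(3) by (simp add: openin_subtopology_Int2)
  then have "openin (top_of_set (snd c ` fst c)) (snd c ` (fst c \<inter> W))"
    using homeomorphic_imp_open_map[OF chart_homeomorphic(3)[OF assms(1,2)]] by (simp add: open_map_def)
  then show ?thesis using chart_homeomorphic(2)[OF assms(1,2)] openin_open_trans by blast
qed

lemma chart_open_preimage:
  assumes "smooth_manifold M" "c \<in> atlas M" "open Q"
  shows "openin (topo M) {x \<in> fst c. snd c x \<in> Q}"
proof -
  have "continuous_map (subtopology (topo M) (fst c)) (top_of_set (snd c ` fst c)) (snd c)"
    by (rule homeomorphic_imp_continuous_map[OF chart_homeomorphic(3)[OF assms(1,2)]])
  then have "openin (subtopology (topo M) (fst c))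
      {x \<in> topspace (subtopology (topo M) (fst c)). snd c x \<in> snd c ` fst c \<inter> Q}"
    using assms(3) by (intro openin_continuous_map_preimage) (auto simp: openin_open)
  moreover have "{x \<in> topspace (subtopology (topo M) (fst c)). snd c x \<in> snd c ` fst c \<inter> Q}
      = {x \<in> fst c. snd c x \<in> Q}"
    unfolding chart_topspace(2)[OF assms(1,2)] by blast
  ultimately have "openin (subtopology (topo M) (fst c)) {x \<in> fst c. snd c x \<in> Q}" by (simp only:)
  then show ?thesis using chart_homeomorphic(1)[OF assms(1,2)] by (rule openin_trans_full)
qed

lemma transition_smooth:
  assumes "smooth_manifold M" "c \<in> atlas M" "d \<in> atlas M"
  shows "open (snd c ` (fst c \<inter> fst d))" "smooth_on (snd c ` (fst c \<inter> fst d)) (snd d \<circ> chart_inv c)"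
  using chart_open_image[OF assms(1,2) chart_homeomorphic(1)[OF assms(1,3)]] assms
  unfolding smooth_manifold_def by blast+

lemma transition_has_derivative:
  assumes "smooth_manifold M" "c \<in> atlas M" "d \<in> atlas M" "x \<in> fst c" "x \<in> fst d"
  shows "((snd d \<circ> chart_inv c) has_derivative
    frechet_derivative (snd d \<circ> chart_inv c) (at (snd c x))) (at (snd c x))"
  by (rule smooth_on_has_derivative[OF transition_smooth(2)[OF assms(1-3)]]) (use assms in blast)

lemma tangent_spaceI:
  assumes "\<And>c d. c \<in> atlas M \<Longrightarrow> d \<in> atlas M \<Longrightarrow> x \<in> fst c \<Longrightarrow> x \<in> fst d \<Longrightarrow>
      v d = frechet_derivative (snd d \<circ> chart_inv c) (at (snd c x)) (v c)"
    and "\<And>c. c \<notin> atlas M \<or> x \<notin> fst c \<Longrightarrow> v c = 0"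
  shows "v \<in> tangent_space M x"
  using assms unfolding tangent_space_def mem_Collect_eq by blast

lemma tangent_spaceD:
  assumes "v \<in> tangent_space M x"
  shows "c \<in> atlas M \<Longrightarrow> d \<in> atlas M \<Longrightarrow> x \<in> fst c \<Longrightarrow> x \<in> fst d \<Longrightarrow>
      v d = frechet_derivative (snd d \<circ> chart_inv c) (at (snd c x)) (v c)"
    and "c \<notin> atlas M \<or> x \<notin> fst c \<Longrightarrow> v c = 0"
  using assms unfolding tangent_space_def mem_Collect_eq by blast+

lemma subspace_tangent_space:
  assumes M: "smooth_manifold M"
  shows "subspace (tangent_space M x)"
proof -
  have lin: "linear (frechet_derivative (snd d \<circ> chart_inv c) (at (snd c x)))"
    if "c \<in> atlas M" "d \<in> atlas M" "x \<in> fst c" "x \<in> fst d" for c d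
    using transition_has_derivative[OF M that] has_derivative_linear by blast
  show ?thesis
  proof (rule subspaceI)
    show "0 \<in> tangent_space M x"
      by (rule tangent_spaceI) (simp_all add: linear_0[OF lin])
  next
    fix v w assume v: "v \<in> tangent_space M x" and w: "w \<in> tangent_space M x"
    show "v + w \<in> tangent_space M x"
    proof (rule tangent_spaceI)
      fix c d assume cd: "c \<in> atlas M" "d \<in> atlas M" "x \<in> fst c" "x \<in> fst d"
      show "(v + w) d = frechet_derivative (snd d \<circ> chart_inv c) (at (snd c x)) ((v + w) c)"
        by (simp only: plus_fun_apply linear_add[OF lin[OF cd]] tangent_spaceD(1)[OF v cd] tangent_spaceD(1)[OF w cd])
    qed (simp add: tangent_spaceD(2)[OF v] tangent_spaceD(2)[OF w])
  next
    fix r v assume v: "v \<in> tangent_space M x"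
    show "r *\<^sub>R v \<in> tangent_space M x"
    proof (rule tangent_spaceI)
      fix c d assume cd: "c \<in> atlas M" "d \<in> atlas M" "x \<in> fst c" "x \<in> fst d"
      show "(r *\<^sub>R v) d = frechet_derivative (snd d \<circ> chart_inv c) (at (snd c x)) ((r *\<^sub>R v) c)"
        by (simp only: scaleR_fun_def linear_cmul[OF lin[OF cd]] tangent_spaceD(1)[OF v cd])
    qed (simp add: scaleR_fun_def tangent_spaceD(2)[OF v])
  qed
qed

text \<open>The transition derivatives determine all components of a tangent vector from a single
  one, and elsewhere the family is zero; so equalities can be checked in one chart.\<close>

lemma tangent_vector_eqI:
  assumes v: "v \<in> tangent_space M x" and w: "w \<in> tangent_space M x"
    and c: "c \<in> atlas M" "x \<in> fst c" and eq: "v c = w c"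
  shows "v = w"
proof
  fix d
  show "v d = w d"
  proof (cases "d \<in> atlas M \<and> x \<in> fst d")
    case True
    then show ?thesis using tangent_spaceD(1)[OF v, of c d] tangent_spaceD(1)[OF w, of c d] c eq by metis
  next
    case False
    then show ?thesis using tangent_spaceD(2)[OF v, of d] tangent_spaceD(2)[OF w, of d] by metis
  qed
qed

text \<open>\<open>tangent_map\<close> uses an unspecified chart at \<open>x\<close>. The chain rule
  with the transition map to \<open>c\<close>, together with the transformation law of
  \<open>v\<close>, replaces it by the given chart.\<close>

lemma tangent_map_chart:
  assumes M: "smooth_manifold M" and v: "v \<in> tangent_space M x" and c: "c \<in> atlas M" "x \<in> fst c"
    and d: "d \<in> atlas N" "f x \<in> fst d"
    and diff: "(snd d \<circ> f \<circ> chart_inv c) differentiable (at (snd c x))"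
  shows "tangent_map M N f x v d = frechet_derivative (snd d \<circ> f \<circ> chart_inv c) (at (snd c x)) (v c)"
proof -
  define b where "b = (SOME c. c \<in> atlas M \<and> x \<in> fst c)"
  have b: "b \<in> atlas M" "x \<in> fst b"
    using someI_ex[of "\<lambda>c. c \<in> atlas M \<and> x \<in> fst c"] c unfolding b_def by blast+
  let ?t = "snd c \<circ> chart_inv b" and ?F = "snd d \<circ> f \<circ> chart_inv c"
  have tx: "?t (snd b x) = snd c x" using chart_inv_chart[OF M b] by simp
  have t: "(?t has_derivative frechet_derivative ?t (at (snd b x))) (at (snd b x))"
    by (rule transition_has_derivative[OF M b(1) c(1) b(2) c(2)])
  have "(?F has_derivative frechet_derivative ?F (at (snd c x))) (at (?t (snd b x)))"
    using diff unfolding tx by (simp add: frechet_derivative_works)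
  from diff_chain_at[OF t this]
  have ch: "(?F \<circ> ?t has_derivative frechet_derivative ?F (at (snd c x)) \<circ> frechet_derivative ?t (at (snd b x)))
      (at (snd b x))" .
  have "(snd d \<circ> f \<circ> chart_inv b has_derivative
      frechet_derivative ?F (at (snd c x)) \<circ> frechet_derivative ?t (at (snd b x))) (at (snd b x))"
  proof (rule has_derivative_transform_within_open[OF ch transition_smooth(1)[OF M b(1) c(1)]])
    show "snd b x \<in> snd b ` (fst b \<inter> fst c)" using b c by blast
    fix y assume "y \<in> snd b ` (fst b \<inter> fst c)"
    then show "(?F \<circ> ?t) y = (snd d \<circ> f \<circ> chart_inv b) y"
      by (auto simp: chart_inv_chart[OF M b(1)] chart_inv_chart[OF M c(1)])
  qed
  from frechet_derivative_at[OF this]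
  have "frechet_derivative (snd d \<circ> f \<circ> chart_inv b) (at (snd b x)) (v b)
      = frechet_derivative ?F (at (snd c x)) (frechet_derivative ?t (at (snd b x)) (v b))"
    by (metis comp_apply)
  also have "frechet_derivative ?t (at (snd b x)) (v b) = v c"
    by (rule tangent_spaceD(1)[OF v b(1) c(1) b(2) c(2), symmetric])
  finally show ?thesis unfolding tangent_map_def Let_def b_def[symmetric] by (simp only: d simp_thms if_True)
qed

text \<open>In the chart \<open>c\<close>, over \<open>Q\<close>, the drift is \<open>A\<close> and \<open>B\<close> is a field along the distribution that is
  normalised by the cost.\<close>

definition unit_rep :: "('m, 'e::euclidean_space) affine_structure \<Rightarrow> ('m, 'e) chart \<Rightarrow> 'e set \<Rightarrow>
    ('e \<Rightarrow> 'e) \<Rightarrow> ('e \<Rightarrow> 'e) \<Rightarrow> bool" where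
  "unit_rep S c Q A B \<longleftrightarrow> c \<in> atlas S \<and> open Q \<and> Q \<subseteq> snd c ` fst c \<and> smooth_on Q A \<and> smooth_on Q B \<and>
    (\<forall>x\<in>fst c. snd c x \<in> Q \<longrightarrow> drift S x \<in> tangent_space S x \<and> drift S x c = A (snd c x) \<and>
      (\<exists>t\<in>tangent_space S x. t c = B (snd c x) \<and>
         affdist S `` {x} = {drift S x + u *\<^sub>R t | u. True} \<and>
         (\<forall>u. cost S (x, drift S x + u *\<^sub>R t) = u\<^sup>2 / 2)))"

text \<open>A framing field is divided by the square root of its cost coefficient. Independence from
  the drift is strict affinity: a drift lying along the distribution would make the fiber a line
  through the origin.\<close>

lemma unit_rep_exists:
  fixes S :: "('m, 'e::euclidean_space) affine_structure"
  assumes M: "smooth_manifold S" and F: "point_affine_distribution 1 S" and aff: "strictly_affine S"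
    and Q: "positive_definite_quadratic_cost 1 S" and p: "p \<in> points S"
  obtains c Q A B where "unit_rep S c Q A B" "p \<in> fst c" "snd c p \<in> Q"
    "\<And>y a b. y \<in> Q \<Longrightarrow> a *\<^sub>R A y + b *\<^sub>R B y = 0 \<Longrightarrow> a = 0 \<and> b = 0"
proof -
  obtain c where c: "c \<in> atlas S" "p \<in> fst c" using M p unfolding smooth_manifold_def by blast
  from Q have "\<forall>p\<in>points S. \<exists>W w g. p \<in> W \<and> local_framing S 1 W w \<and>
        (\<forall>i<1. \<forall>j<1. smooth_function S W (g i j)) \<and>
        (\<forall>x\<in>W.
           (\<forall>i<1. \<forall>j<1. g i j x = g j i x) \<and>
           (\<forall>u::nat \<Rightarrow> real. (\<exists>i<1. u i \<noteq> 0) \<longrightarrow> (\<Sum>i<1. \<Sum>j<1. g i j x * u i * u j) > 0) \<and>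
           (\<forall>u::nat \<Rightarrow> real. cost S (x, drift S x + (\<Sum>i<1. u i *\<^sub>R w i x))
              = 1/2 * (\<Sum>i<1. \<Sum>j<1. g i j x * u i * u j)))"
    by (simp only: positive_definite_quadratic_cost_def)
  from bspec[OF this p] obtain W w g where pW: "p \<in> W" and fr: "local_framing S 1 W w"
    and g1: "\<forall>i<1::nat. \<forall>j<1::nat. smooth_function S W (g i j)"
    and gx: "\<forall>x\<in>W.
       (\<forall>i<1. \<forall>j<1. g i j x = g j i x) \<and>
       (\<forall>u::nat \<Rightarrow> real. (\<exists>i<1. u i \<noteq> 0) \<longrightarrow> (\<Sum>i<1. \<Sum>j<1. g i j x * u i * u j) > 0) \<and>
       (\<forall>u::nat \<Rightarrow> real. cost S (x, drift S x + (\<Sum>i<1. u i *\<^sub>R w i x))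
          = 1/2 * (\<Sum>i<1. \<Sum>j<1. g i j x * u i * u j))"
    by (elim exE conjE) (rule that)
  have g: "smooth_function S W (g 0 0)" using g1 by simp
  \<comment> \<open>In rank 1 the coefficient matrix is the single entry \<open>g 0 0\<close>;
    constant control vectors extract its properties.\<close>
  have pos: "g 0 0 x > 0" if "x \<in> W" for x
    using gx[rule_format, OF that, THEN conjunct2, THEN conjunct1, rule_format, of "\<lambda>_. 1"] by simp
  have cost: "cost S (x, drift S x + u *\<^sub>R w 0 x) = 1/2 * (g 0 0 x * u * u)" if "x \<in> W" for x u
    using gx[rule_format, OF that, THEN conjunct2, THEN conjunct2, rule_format, of "\<lambda>_. u"] by simp
  have W: "openin (topo S) W" and w: "smooth_vector_field S W (w 0)"
    and w0: "\<And>x. x \<in> W \<Longrightarrow> w 0 x \<noteq> 0"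
    and fib: "\<And>x. x \<in> W \<Longrightarrow> affdist S `` {x} = (\<lambda>v. drift S x + v) ` span {w 0 x}"
    using fr unfolding local_framing_def by (auto simp: lessThan_Suc)
  define Q where "Q = snd c ` (fst c \<inter> W)"
  \<comment> \<open>Chosen so that the coefficient of the rescaled field, \<open>g 0 0\<close> times
    the square of \<open>k\<close>, is 1.\<close>
  define k where "k x = inverse (sqrt (g 0 0 x))" for x
  define A where "A y = drift S (chart_inv c y) c" for y
  define B where "B y = k (chart_inv c y) *\<^sub>R w 0 (chart_inv c y) c" for y
  have oQ: "open Q" unfolding Q_def by (rule chart_open_image[OF M c(1) W])
  have inv: "chart_inv c (snd c x) = x" if "x \<in> fst c" for x by (rule chart_inv_chart[OF M c(1) that])
  have drift: "smooth_vector_field S (points S) (drift S)"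
    using F unfolding point_affine_distribution_def by blast
  have drift_tan: "drift S x \<in> tangent_space S x" if "x \<in> fst c" for x
    using drift chart_topspace(1)[OF M c(1)] that unfolding smooth_vector_field_def by blast
  have w_tan: "w 0 x \<in> tangent_space S x" if "x \<in> W" for x
    using w that unfolding smooth_vector_field_def by blast
  have WQ: "x \<in> W" if "x \<in> fst c" "snd c x \<in> Q" for x
    using that inj_onD[OF chart_inj_on[OF M c(1)]] unfolding Q_def by blast
  have sA: "smooth_on Q A"
  proof -
    have "smooth_on (snd c ` (fst c \<inter> points S)) A"
      using drift c(1) unfolding smooth_vector_field_def A_def by blast
    moreover have "Q \<subseteq> snd c ` (fst c \<inter> points S)"
      unfolding Q_def using chart_topspace(1)[OF M c(1)] by blast
    ultimately show ?thesis by (rule smooth_on_subset)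
  qed
  have sB: "smooth_on Q B"
  proof -
    have sg: "smooth_on Q (\<lambda>y. g 0 0 (chart_inv c y))"
      using g c(1) unfolding smooth_function_def Q_def by (auto simp: o_def)
    have gpos: "g 0 0 (chart_inv c y) > 0" if "y \<in> Q" for y
      using that pos inv unfolding Q_def by auto
    then have "smooth_on Q (\<lambda>y. inverse (sqrt (g 0 0 (chart_inv c y))))"
      by (intro smooth_on_inverse smooth_on_sqrt oQ sg) (auto dest: gpos)
    then show ?thesis unfolding B_def k_def
      using w c(1) unfolding smooth_vector_field_def Q_def
      by (intro smooth_on_scaleR[OF oQ[unfolded Q_def]]) auto
  qed
  define t where "t x = k x *\<^sub>R w 0 x" for x
  have k: "k x > 0" "g 0 0 x * k x * k x = 1" if "x \<in> W" for x
    using pos[OF that] by (simp_all add: k_def field_simps)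
  have t_tan: "t x \<in> tangent_space S x" if "x \<in> W" for x
    unfolding t_def by (rule subspace_scale[OF subspace_tangent_space[OF M] w_tan[OF that]])
  have tc: "t x c = B (snd c x)" if "x \<in> fst c" for x
    using inv[OF that] by (simp add: t_def B_def scaleR_fun_def)
  have span_t: "span {w 0 x} = range (\<lambda>u. u *\<^sub>R t x)" if "x \<in> W" for x
  proof -
    have "u *\<^sub>R w 0 x \<in> range (\<lambda>u. u *\<^sub>R t x)" for u
      using k(1)[OF that] by (intro range_eqI[where x="u / k x"]) (simp add: t_def)
    moreover have "u *\<^sub>R t x \<in> range (\<lambda>u. u *\<^sub>R w 0 x)" for u
      by (intro range_eqI[where x="u * k x"]) (simp add: t_def)
    ultimately show ?thesis unfolding span_singleton by blast
  qed
  have fib': "affdist S `` {x} = {drift S x + u *\<^sub>R t x | u. True}" if "x \<in> W" for x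
    unfolding fib[OF that] span_t[OF that] by blast
  have cost': "cost S (x, drift S x + u *\<^sub>R t x) = u\<^sup>2 / 2" if "x \<in> W" for x u
  proof -
    have "cost S (x, drift S x + u *\<^sub>R t x) = 1/2 * (g 0 0 x * (u * k x) * (u * k x))"
      using cost[OF that, of "u * k x"] by (simp add: t_def)
    also have "\<dots> = (g 0 0 x * k x * k x) * u\<^sup>2 / 2" by (simp add: power2_eq_square)
    finally show ?thesis using k(2)[OF that] by simp
  qed
  have rep: "unit_rep S c Q A B"
    unfolding unit_rep_def
    using c oQ sA sB drift_tan t_tan tc fib' cost' WQ inv
    by (auto simp: Q_def[symmetric] A_def intro!: bexI[where x="t _"]) (auto simp: Q_def)
  have "a = 0 \<and> b = 0" if y: "y \<in> Q" and eq: "a *\<^sub>R A y + b *\<^sub>R B y = 0" for y a b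
  proof -
    obtain x where x: "x \<in> fst c" "x \<in> W" "y = snd c x" using y unfolding Q_def by blast
    note sub = subspace_tangent_space[OF M, of x]
    have eq0: "a *\<^sub>R drift S x + b *\<^sub>R t x = 0"
    proof (rule tangent_vector_eqI[OF _ _ c(1) x(1)])
      show "a *\<^sub>R drift S x + b *\<^sub>R t x \<in> tangent_space S x"
        by (intro subspace_add[OF sub] subspace_scale[OF sub] drift_tan t_tan x)
      show "0 \<in> tangent_space S x" by (rule subspace_0[OF sub])
      show "(a *\<^sub>R drift S x + b *\<^sub>R t x) c = 0 c"
        using eq tc[OF x(1)] inv[OF x(1)] by (simp add: x(3) A_def scaleR_fun_def)
    qed
    moreover have "a = 0"
    proof (rule ccontr)
      \<comment> \<open>Then the drift is a multiple of \<open>t x\<close>, and translating the line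
        by it gives the same line, a subspace.\<close>
      assume a: "a \<noteq> 0"
      have "drift S x = inverse a *\<^sub>R (a *\<^sub>R drift S x)" using a by simp
      also have "a *\<^sub>R drift S x = - (b *\<^sub>R t x)" using eq0 by (simp add: eq_neg_iff_add_eq_0)
      also have "inverse a *\<^sub>R - (b *\<^sub>R t x) = (- (b / a)) *\<^sub>R t x"
        by (simp only: scaleR_minus_right scaleR_minus_left scaleR_scaleR divide_inverse mult.commute)
      finally have dr: "drift S x = (- (b / a)) *\<^sub>R t x" .
      have "affdist S `` {x} = span {w 0 x}"
        unfolding fib'[OF x(2)] span_t[OF x(2)] dr
      proof (intro equalityI subsetI)
        fix v assume "v \<in> range (\<lambda>u. u *\<^sub>R t x)"
        then obtain u where "v = u *\<^sub>R t x" by blast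
        then have "v = (- (b / a) + (u + b / a)) *\<^sub>R t x" by simp
        then have "v = (- (b / a)) *\<^sub>R t x + (u + b / a) *\<^sub>R t x" by (simp only: scaleR_add_left)
        then show "v \<in> {(- (b / a)) *\<^sub>R t x + u *\<^sub>R t x | u. True}" by blast
      next
        fix v assume "v \<in> {(- (b / a)) *\<^sub>R t x + u *\<^sub>R t x | u. True}"
        then obtain u where "v = (- (b / a)) *\<^sub>R t x + u *\<^sub>R t x" by blast
        then have "v = (- (b / a) + u) *\<^sub>R t x" by (simp only: scaleR_add_left)
        then show "v \<in> range (\<lambda>u. u *\<^sub>R t x)" by blast
      qed
      moreover have "x \<in> points S" using openin_subset[OF W] x by blast
      ultimately show False using aff unfolding strictly_affine_def by (metis subspace_span)
    qed
    ultimately show ?thesis using k(1)[OF x(2)] w0[OF x(2)] by (simp add: t_def)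
  qed
  moreover have "snd c p \<in> Q" using c pW unfolding Q_def by blast
  ultimately show ?thesis using that[OF rep] c by blast
qed

section \<open>Isometries in charts\<close>

lemma unit_repD:
  assumes "unit_rep S c Q A B"
  shows "c \<in> atlas S" "open Q" "Q \<subseteq> snd c ` fst c" "smooth_on Q A" "smooth_on Q B"
    and "x \<in> fst c \<Longrightarrow> snd c x \<in> Q \<Longrightarrow> drift S x \<in> tangent_space S x"
    and "x \<in> fst c \<Longrightarrow> snd c x \<in> Q \<Longrightarrow> drift S x c = A (snd c x)"
    and "x \<in> fst c \<Longrightarrow> snd c x \<in> Q \<Longrightarrow> \<exists>t\<in>tangent_space S x. t c = B (snd c x) \<and>
         affdist S `` {x} = {drift S x + u *\<^sub>R t | u. True} \<and>
         (\<forall>u. cost S (x, drift S x + u *\<^sub>R t) = u\<^sup>2 / 2)"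
  using assms unfolding unit_rep_def by blast+

text \<open>The drift is preserved, so the image of drift plus unit field is the drift plus some
  multiple \<open>u\<close> of the unit field at the image point; equality of costs forces
  \<open>u\<^sup>2 = 1\<close>. At this stage the sign may still depend on the point.\<close>

lemma isometry_in_charts:
  fixes S :: "('m, 'e::euclidean_space) affine_structure"
  assumes M: "smooth_manifold S" and rep: "unit_rep S c Q A B" and rep': "unit_rep S c' Q' A' B'"
    and iso: "point_affine_isometry S S U V f"
    and p: "p \<in> U" "p \<in> fst c" "snd c p \<in> Q" "f p \<in> fst c'" "snd c' (f p) \<in> Q'"
  obtains R F where "open R" "snd c p \<in> R" "R \<subseteq> Q" "smooth_on R F" "F ` R \<subseteq> Q'" "F (snd c p) = snd c' (f p)"
    "\<And>y. y \<in> R \<Longrightarrow> frechet_derivative F (at y) (A y) = A' (F y)"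
    "\<And>y. y \<in> R \<Longrightarrow> \<exists>e. e\<^sup>2 = 1 \<and> frechet_derivative F (at y) (B y) = e *\<^sub>R B' (F y)"
proof -
  note D = unit_repD[OF rep] and D' = unit_repD[OF rep']
  have diffeo: "diffeomorphism_between S S U V f"
    and isoD: "\<And>x. x \<in> U \<Longrightarrow> tangent_map S S f x (drift S x) = drift S (f x)"
      "\<And>x. x \<in> U \<Longrightarrow> tangent_map S S f x ` (affdist S `` {x}) = affdist S `` {f x}"
      "\<And>x v. x \<in> U \<Longrightarrow> v \<in> affdist S `` {x} \<Longrightarrow> cost S (f x, tangent_map S S f x v) = cost S (x, v)"
    using iso unfolding point_affine_isometry_def by blast+
  have U: "openin (topo S) U" and V: "openin (topo S) V"
    and hom: "homeomorphic_map (subtopology (topo S) U) (subtopology (topo S) V) f"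
    and smf: "smooth_map S S U f"
    using diffeo unfolding diffeomorphism_between_def by blast+
  define N where "N = {z \<in> fst c'. snd c' z \<in> Q'}"
  \<comment> \<open>Only points whose image falls in the second chart, over \<open>Q'\<close>, can
    be treated; continuity of \<open>f\<close> makes this set open.\<close>
  define X where "X = {x \<in> U. f x \<in> N}"
  have oN: "openin (topo S) N" unfolding N_def by (rule chart_open_preimage[OF M D'(1,2)])
  have "continuous_map (subtopology (topo S) U) (topo S) f"
    using homeomorphic_imp_continuous_map[OF hom] continuous_map_in_subtopology by blast
  from openin_continuous_map_preimage[OF this oN]
  have "openin (subtopology (topo S) U) X"
    using openin_subset[OF U] unfolding X_def by (simp add: Int_absorb1)
  then have oX: "openin (topo S) X" using U by (rule openin_trans_full)
  define R where "R = Q \<inter> snd c ` (fst c \<inter> X)"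
  define F where "F = snd c' \<circ> f \<circ> chart_inv c"
  have inv: "chart_inv c (snd c x) = x" if "x \<in> fst c" for x by (rule chart_inv_chart[OF M D(1) that])
  have Rx: "\<exists>x. x \<in> fst c \<and> x \<in> U \<and> f x \<in> fst c' \<and> snd c' (f x) \<in> Q' \<and> y = snd c x \<and> snd c x \<in> Q \<and> F y = snd c' (f x)"
    if "y \<in> R" for y
    using that inv unfolding R_def X_def N_def F_def by auto
  have oR: "open R" unfolding R_def by (intro open_Int D(2) chart_open_image[OF M D(1) oX])
  have sF: "smooth_on R F"
  proof (rule smooth_on_subset)
    show "smooth_on (snd c ` (fst c \<inter> U \<inter> f -` fst c')) F"
      using smf D(1) D'(1) unfolding smooth_map_def F_def by blast
    show "R \<subseteq> snd c ` (fst c \<inter> U \<inter> f -` fst c')"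
      unfolding R_def X_def N_def by blast
  qed
  have main: "frechet_derivative F (at y) (A y) = A' (F y)
      \<and> (\<exists>e. e\<^sup>2 = 1 \<and> frechet_derivative F (at y) (B y) = e *\<^sub>R B' (F y))" if y: "y \<in> R" for y
  proof -
    obtain x where x: "x \<in> fst c" "x \<in> U" and fx: "f x \<in> fst c'" "snd c' (f x) \<in> Q'"
      and yx: "y = snd c x" "snd c x \<in> Q" and Fy: "F y = snd c' (f x)"
      using Rx[OF y] by blast
    note Fd = smooth_on_has_derivative[OF sF y]
    have lin: "linear (frechet_derivative F (at y))" using Fd has_derivative_linear by blast
    have tm: "tangent_map S S f x v c' = frechet_derivative F (at y) (v c)" if "v \<in> tangent_space S x" for v
      unfolding F_def yx(1)
      by (rule tangent_map_chart[where f=f, OF M that D(1) x(1) D'(1) fx(1)])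
        (use Fd in \<open>auto simp: differentiable_def F_def yx(1)\<close>)
    have A: "frechet_derivative F (at y) (A y) = A' (F y)"
      using tm[OF D(6)[OF x(1) yx(2)]] unfolding isoD(1)[OF x(2)] D(7)[OF x(1) yx(2)] D'(7)[OF fx] by (simp add: Fy yx(1)[symmetric])
    obtain t where t: "t \<in> tangent_space S x" "t c = B y"
      "affdist S `` {x} = {drift S x + u *\<^sub>R t | u. True}"
      "\<And>u. cost S (x, drift S x + u *\<^sub>R t) = u\<^sup>2 / 2"
      using D(8)[OF x(1) yx(2)] unfolding yx(1) by blast
    obtain t' where t': "t' \<in> tangent_space S (f x)" "t' c' = B' (F y)"
      "affdist S `` {f x} = {drift S (f x) + u *\<^sub>R t' | u. True}"
      "\<And>u. cost S (f x, drift S (f x) + u *\<^sub>R t') = u\<^sup>2 / 2"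
      using D'(8)[OF fx] unfolding Fy by blast
    let ?v = "drift S x + 1 *\<^sub>R t"
    have v: "?v \<in> affdist S `` {x}" unfolding t(3) by blast
    then have "tangent_map S S f x ?v \<in> affdist S `` {f x}" using isoD(2)[OF x(2)] by blast
    then obtain u where u: "tangent_map S S f x ?v = drift S (f x) + u *\<^sub>R t'" unfolding t'(3) by blast
    have "cost S (f x, drift S (f x) + u *\<^sub>R t') = cost S (x, ?v)"
      using isoD(3)[OF x(2) v] by (simp only: u)
    then have u2: "u\<^sup>2 = 1" unfolding t(4) t'(4) by simp
    have vt: "?v \<in> tangent_space S x"
      using subspace_add[OF subspace_tangent_space[OF M] D(6)[OF x(1) yx(2)] t(1)] by simp
    have "frechet_derivative F (at y) (?v c) = (drift S (f x) + u *\<^sub>R t') c'"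
      using tm[OF vt] by (simp only: u)
    then have "frechet_derivative F (at y) (A y + B y) = A' (F y) + u *\<^sub>R B' (F y)"
      using D(7)[OF x(1) yx(2)] D'(7)[OF fx] t(2) t'(2) by (simp add: scaleR_fun_def Fy yx(1)[symmetric])
    then have "frechet_derivative F (at y) (B y) = u *\<^sub>R B' (F y)"
      by (simp add: linear_add[OF lin] A)
    then show ?thesis using A u2 by blast
  qed
  have pR: "snd c p \<in> R" using p unfolding R_def X_def N_def by blast
  show ?thesis
  proof (rule that[OF oR pR _ sF])
    show "R \<subseteq> Q" unfolding R_def by blast
    show "F ` R \<subseteq> Q'" using Rx by force
    show "F (snd c p) = snd c' (f p)" using inv[OF p(2)] by (simp add: F_def)
  qed (use main in blast)+
qed

text \<open>Once the sign e is known to be locally constant, naturality gives DF[A, B] = e [A', B'].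
  Comparing components, e cancels in the coefficient of \<open>B\<close> but remains in that of
  \<open>A\<close>, so only the square of the latter is invariant.\<close>

lemma bracket_coefficients_invariant:
  fixes F :: "'a::euclidean_space \<Rightarrow> 'a"
  assumes co: "coframe Q A B \<alpha> \<beta>" and co': "coframe Q' A' B' \<alpha>' \<beta>'"
    and R: "open R" "y \<in> R" "R \<subseteq> Q" and F: "smooth_on R F" "F ` R \<subseteq> Q'"
    and FA: "\<And>y. y \<in> R \<Longrightarrow> frechet_derivative F (at y) (A y) = A' (F y)"
    and FB: "\<And>y. y \<in> R \<Longrightarrow> \<exists>e. e\<^sup>2 = 1 \<and> frechet_derivative F (at y) (B y) = e *\<^sub>R B' (F y)"
  shows "\<beta> y \<bullet> bracket A B y = \<beta>' (F y) \<bullet> bracket A' B' (F y)"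
    and "(\<alpha> y \<bullet> bracket A B y)\<^sup>2 = (\<alpha>' (F y) \<bullet> bracket A' B' (F y))\<^sup>2"
proof -
  note c = coframeD[OF co] and c' = coframeD[OF co']
  \<comment> \<open>The sign recovered by the dual form, a formula that is visibly continuous in
    \<open>z\<close>, unlike the pointwise existential witness.\<close>
  define e where "e z = \<beta>' (F z) \<bullet> frechet_derivative F (at z) (B z)" for z
  have FR: "F z \<in> Q'" if "z \<in> R" for z using F(2) that by blast
  have e: "(e z)\<^sup>2 = 1" "frechet_derivative F (at z) (B z) = e z *\<^sub>R B' (F z)" if z: "z \<in> R" for z
  proof -
    obtain k where k: "k\<^sup>2 = 1" "frechet_derivative F (at z) (B z) = k *\<^sub>R B' (F z)" using FB[OF z] by blast
    then have "e z = k" by (simp add: e_def c'(9)[OF FR[OF z]])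
    with k show "(e z)\<^sup>2 = 1" "frechet_derivative F (at z) (B z) = e z *\<^sub>R B' (F z)" by simp_all
  qed
  have sAB: "smooth_on R A" "smooth_on R B" using c(2,3) R(3) by (auto intro: smooth_on_subset)
  have "continuous_on R (\<lambda>z. frechet_derivative F (at z) (B z))"
    using has_derivative_apply_field[OF R(1) _ F(1) sAB(2)]
    by (intro continuous_at_imp_continuous_on ballI) (rule has_derivative_continuous)
  moreover have "continuous_on R (\<lambda>z. \<beta>' (F z))"
    by (rule continuous_on_compose2[OF smooth_on_continuous[OF c'(5)] smooth_on_continuous[OF F(1)] F(2)])
  ultimately have cont: "continuous_on R e" unfolding e_def by (intro continuous_intros)
  \<comment> \<open>The open set where the sign agrees with the one at \<open>y\<close>; on it e is
    constant, as \<open>bracket_related\<close> requires.\<close>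
  define R0 where "R0 = {z \<in> R. 0 < e z * e y}"
  have oR0: "open R0"
  proof -
    have "continuous_on R (\<lambda>z. e z * e y)" by (intro continuous_intros cont)
    from continuous_open_preimage[OF this R(1) open_greaterThan[of 0]] show ?thesis
      by (simp add: R0_def vimage_def Int_def)
  qed
  have yR0: "y \<in> R0" using R(2) e(1)[OF R(2)] by (simp add: R0_def power2_eq_square)
  have R0R: "R0 \<subseteq> R" unfolding R0_def by blast
  have eq: "e z = e y" if "z \<in> R0" for z
  proof -
    have "e z = 1 \<or> e z = -1" "e y = 1 \<or> e y = -1"
      using e(1) that R(2) R0R by (auto simp: power2_eq_1_iff)
    then show ?thesis using that by (auto simp: R0_def)
  qed
  let ?F = "frechet_derivative F (at y)"
  have lin: "linear ?F" using smooth_on_has_derivative[OF F(1) R(2)] has_derivative_linear by blast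
  have br: "?F (bracket A B y) = e y *\<^sub>R bracket A' B' (F y)"
  proof (rule bracket_related[OF oR0 yR0, where T=Q'])
    show "smooth_on R0 F" "smooth_on R0 A" "smooth_on R0 B" using F(1) sAB R0R by (auto intro: smooth_on_subset)
    show "F ` R0 \<subseteq> Q'" using F(2) R0R by blast
    show "smooth_on Q' A'" "smooth_on Q' B'" by (rule c')+
    fix z assume z: "z \<in> R0"
    then have zR: "z \<in> R" using R0R by blast
    show "frechet_derivative F (at z) (A z) = A' (F z)" by (rule FA[OF zR])
    show "frechet_derivative F (at z) (B z) = e y *\<^sub>R B' (F z)" using e(2)[OF zR] eq[OF z] by simp
  qed
  have yQ: "y \<in> Q" using R by blast
  note FyQ = FR[OF R(2)]
  have "?F (bracket A B y) = (\<alpha> y \<bullet> bracket A B y) *\<^sub>R A' (F y) + (\<beta> y \<bullet> bracket A B y) *\<^sub>R e y *\<^sub>R B' (F y)"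
    by (subst c(10)[OF yQ, of "bracket A B y"])
      (simp only: linear_add[OF lin] linear_cmul[OF lin] FA[OF R(2)] e(2)[OF R(2)])
  then have eqn: "e y *\<^sub>R bracket A' B' (F y)
      = (\<alpha> y \<bullet> bracket A B y) *\<^sub>R A' (F y) + (\<beta> y \<bullet> bracket A B y) *\<^sub>R e y *\<^sub>R B' (F y)" using br by simp
  have "e y * (\<beta>' (F y) \<bullet> bracket A' B' (F y)) = (\<beta> y \<bullet> bracket A B y) * e y"
    using arg_cong[OF eqn, of "\<lambda>v. \<beta>' (F y) \<bullet> v"] by (simp add: inner_add_right c'(8,9)[OF FyQ])
  moreover have "e y \<noteq> 0" using e(1)[OF R(2)] by auto
  ultimately show "\<beta> y \<bullet> bracket A B y = \<beta>' (F y) \<bullet> bracket A' B' (F y)" by simp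
  have "e y * (\<alpha>' (F y) \<bullet> bracket A' B' (F y)) = \<alpha> y \<bullet> bracket A B y"
    using arg_cong[OF eqn, of "\<lambda>v. \<alpha>' (F y) \<bullet> v"] by (simp add: inner_add_right c'(6,7)[OF FyQ])
  then have "(\<alpha> y \<bullet> bracket A B y)\<^sup>2 = (e y)\<^sup>2 * (\<alpha>' (F y) \<bullet> bracket A' B' (F y))\<^sup>2"
    by (metis power_mult_distrib)
  then show "(\<alpha> y \<bullet> bracket A B y)\<^sup>2 = (\<alpha>' (F y) \<bullet> bracket A' B' (F y))\<^sup>2"
    using e(1)[OF R(2)] by simp
qed

section \<open>Local isometries to a model\<close>

lemma std_tvec_standard_chart [simp]: "std_tvec \<Omega> v (standard_chart \<Omega>) = v"
  by (simp add: std_tvec_def)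

text \<open>The cost has to be a function of the tangent vector, so the control is recovered by
  projecting the difference from the drift onto \<open>v\<^sub>2\<close>, which is possible where
  \<open>v\<^sub>2\<close> does not vanish.\<close>

lemma rank1_structure_exists:
  fixes \<Omega> :: "'e::euclidean_space set"
  assumes "open \<Omega>" and nz: "\<And>x. x \<in> \<Omega> \<Longrightarrow> v\<^sub>2 x \<noteq> 0"
  obtains T where "rank1_structure_on \<Omega> v\<^sub>1 v\<^sub>2 G T"
proof -
  define T :: "('e, 'e) affine_structure" where "T = \<lparr>topo = top_of_set \<Omega>, atlas = {standard_chart \<Omega>},
    drift = \<lambda>x. std_tvec \<Omega> (v\<^sub>1 x),
    affdist = {(x, std_tvec \<Omega> (v\<^sub>1 x + u *\<^sub>R v\<^sub>2 x)) | x u. x \<in> \<Omega>},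
    cost = \<lambda>(x, v). 1/2 * G x * (((v (standard_chart \<Omega>) - v\<^sub>1 x) \<bullet> v\<^sub>2 x) / (v\<^sub>2 x \<bullet> v\<^sub>2 x))\<^sup>2\<rparr>"
  have "rank1_structure_on \<Omega> v\<^sub>1 v\<^sub>2 G T"
    unfolding rank1_structure_on_def using assms by (auto simp: T_def)
  then show ?thesis by (rule that)
qed

lemma inv_into_standard_chart: "y \<in> \<Omega> \<Longrightarrow> chart_inv (standard_chart \<Omega>) y = y"
  using inv_into_f_f[of "\<lambda>x. x" \<Omega> y] by (simp add: standard_chart_def)

text \<open>Transfers a coordinate change of plane fields back to the manifold. Since
  \<open>B\<close> has unit cost while the model field has coefficient \<open>G\<close>, costs match
  exactly when the factor \<open>k\<close> between them satisfies \<open>k\<^sup>2 * G = 1\<close>;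
  it may vary with the point.\<close>

lemma local_isometry_to_model:
  fixes S :: "('m, 'e::euclidean_space) affine_structure"
  assumes M: "smooth_manifold S" and rep: "unit_rep S c Q A B" and p: "p \<in> fst c" "snd c p \<in> U"
    and T: "rank1_structure_on \<Omega> v\<^sub>1 v\<^sub>2 G T"
    and U: "open U" "U \<subseteq> Q" and V: "open V" "V \<subseteq> \<Omega>" and hom: "homeomorphism U V \<phi> \<psi>"
    and sm: "smooth_on U \<phi>" "smooth_on V \<psi>"
    and dA: "\<And>y. y \<in> U \<Longrightarrow> frechet_derivative \<phi> (at y) (A y) = v\<^sub>1 (\<phi> y)"
    and dB: "\<And>y. y \<in> U \<Longrightarrow>
      \<exists>k. k \<noteq> 0 \<and> frechet_derivative \<phi> (at y) (B y) = k *\<^sub>R v\<^sub>2 (\<phi> y) \<and> k\<^sup>2 * G (\<phi> y) = 1"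
  shows "\<exists>U V f. p \<in> U \<and> point_affine_isometry S T U V f"
proof -
  note D = unit_repD[OF rep]
  have topoT: "topo T = top_of_set \<Omega>" and atlasT: "atlas T = {standard_chart \<Omega>}"
    and driftT: "\<And>x. x \<in> \<Omega> \<Longrightarrow> drift T x = std_tvec \<Omega> (v\<^sub>1 x)"
    and affT: "affdist T = {(x, std_tvec \<Omega> (v\<^sub>1 x + u *\<^sub>R v\<^sub>2 x)) | x u. x \<in> \<Omega>}"
    and costT: "\<And>x u. x \<in> \<Omega> \<Longrightarrow> cost T (x, std_tvec \<Omega> (v\<^sub>1 x + u *\<^sub>R v\<^sub>2 x)) = 1/2 * G x * u\<^sup>2"
    using T unfolding rank1_structure_on_def by blast+
  let ?d = "standard_chart \<Omega>"
  have d: "fst ?d = \<Omega>" "snd ?d = (\<lambda>x. x)" by (simp_all add: standard_chart_def)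
  have \<psi>U: "\<psi> y \<in> U" "\<phi> (\<psi> y) = y" if "y \<in> V" for y using hom that by (auto simp: homeomorphism_def)
  have \<phi>V: "\<phi> x \<in> V" "\<psi> (\<phi> x) = x" if "x \<in> U" for x using hom that by (auto simp: homeomorphism_def)
  have UQ: "U \<subseteq> snd c ` fst c" using U(2) D(3) by blast
  have inv: "chart_inv c (snd c x) = x" if "x \<in> fst c" for x by (rule chart_inv_chart[OF M D(1) that])
  define W where "W = {x \<in> fst c. snd c x \<in> U}"
  define f where "f x = \<phi> (snd c x)" for x
  have oW: "openin (topo S) W" unfolding W_def by (rule chart_open_preimage[OF M D(1) U(1)])
  have oV: "openin (topo T) V" unfolding topoT using V by (intro open_subset)
  have fW: "f x \<in> V" if "x \<in> W" for x using that \<phi>V unfolding W_def f_def by blast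
  have inj: "inj_on f W"
  proof (rule inj_onI)
    fix x x' assume "x \<in> W" "x' \<in> W" "f x = f x'"
    then show "x = x'" unfolding W_def f_def by (metis (no_types, lifting) \<phi>V(2) inv mem_Collect_eq)
  qed
  have invf: "inv_into W f y = chart_inv c (\<psi> y)" if y: "y \<in> V" for y
  proof -
    obtain x where x: "x \<in> fst c" "\<psi> y = snd c x" using \<psi>U(1)[OF y] UQ by blast
    have "x \<in> W" "f x = y" using x \<psi>U[OF y] unfolding W_def f_def by auto
    then show ?thesis using inv_into_f_f[OF inj] inv[OF x(1)] x(2) by metis
  qed
  have homf: "homeomorphic_map (subtopology (topo S) W) (subtopology (topo T) V) f"
  proof -
    have "homeomorphic_map (subtopology (subtopology (topo S) (fst c)) W)
        (subtopology (top_of_set (snd c ` fst c)) U) (snd c)"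
    proof (rule homeomorphic_map_subtopologies[OF chart_homeomorphic(3)[OF M D(1)]])
      show "snd c ` (topspace (subtopology (topo S) (fst c)) \<inter> W) = topspace (top_of_set (snd c ` fst c)) \<inter> U"
        unfolding chart_topspace(2)[OF M D(1)] W_def by auto
    qed
    moreover have "fst c \<inter> W = W" "snd c ` fst c \<inter> U = U" using UQ unfolding W_def by blast+
    ultimately have 1: "homeomorphic_map (subtopology (topo S) W) (top_of_set U) (snd c)"
      by (simp add: subtopology_subtopology)
    have "homeomorphic_maps (top_of_set U) (top_of_set V) \<phi> \<psi>"
      using hom unfolding homeomorphism_def homeomorphic_maps_def by auto
    then have "homeomorphic_map (top_of_set U) (top_of_set V) \<phi>" by (rule homeomorphic_maps_imp_map)
    from homeomorphic_map_compose[OF 1 this]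
    have "homeomorphic_map (subtopology (topo S) W) (top_of_set V) f"
      by (simp add: f_def[abs_def] o_def)
    moreover have "\<Omega> \<inter> V = V" using V(2) by blast
    ultimately show ?thesis by (simp add: topoT subtopology_subtopology)
  qed
  have smf: "smooth_map S T W f"
    unfolding smooth_map_def atlasT
  proof (intro ballI)
    fix b e assume b: "b \<in> atlas S" and "e \<in> {?d}"
    then have e: "e = ?d" by simp
    let ?O = "snd b ` (fst b \<inter> W)" and ?t = "snd c \<circ> chart_inv b"
    have O: "open ?O" by (rule chart_open_image[OF M b oW])
    have sub: "?O \<subseteq> snd b ` (fst b \<inter> fst c)" unfolding W_def by blast
    have "?t ` ?O \<subseteq> U" using chart_inv_chart[OF M b] unfolding W_def by auto
    then have "smooth_on ?O (\<lambda>y. \<phi> (?t y))"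
      by (rule smooth_on_compose[OF O U(1) _ sm(1) smooth_on_subset[OF transition_smooth(2)[OF M b D(1)] sub]])
    moreover have "(\<lambda>y. \<phi> (?t y)) = snd e \<circ> f \<circ> chart_inv b" by (simp add: e d f_def o_def)
    moreover have "fst b \<inter> W \<inter> f -` fst e = fst b \<inter> W" using fW V(2) by (auto simp: e d)
    ultimately show "smooth_on (snd b ` (fst b \<inter> W \<inter> f -` fst e)) (snd e \<circ> f \<circ> chart_inv b)" by simp
  qed
  have sminv: "smooth_map T S V (inv_into W f)"
    unfolding smooth_map_def atlasT
  proof (intro ballI)
    fix b e assume b: "b \<in> atlas S" and "e \<in> {?d}"
    then have e: "e = ?d" by simp
    let ?I = "snd c ` (fst c \<inter> fst b)" and ?t = "snd b \<circ> chart_inv c"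
    \<comment> \<open>The part of \<open>V\<close> sent into the chart \<open>b\<close> by the
      inverse map, expressed in coordinates; it is identified below with the set on which
      \<open>smooth_map\<close> demands smoothness.\<close>
    let ?O = "V \<inter> \<psi> -` ?I"
    have O: "open ?O"
      by (rule continuous_open_preimage[OF smooth_on_continuous[OF sm(2)] V(1) transition_smooth(1)[OF M D(1) b]])
    have "smooth_on ?O (\<lambda>y. ?t (\<psi> y))"
      by (rule smooth_on_compose[OF O transition_smooth(1)[OF M D(1) b] _ transition_smooth(2)[OF M D(1) b]
            smooth_on_subset[OF sm(2)]]) auto
    then have *: "smooth_on ?O (snd b \<circ> inv_into W f \<circ> chart_inv e)"
    proof (rule smooth_on_cong[OF O, rotated])
      fix y assume "y \<in> ?O"
      then show "?t (\<psi> y) = (snd b \<circ> inv_into W f \<circ> chart_inv e) y"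
        using V(2) by (auto simp: e invf inv_into_standard_chart subset_iff)
    qed
    have "chart_inv c (\<psi> y) \<in> fst b \<longleftrightarrow> \<psi> y \<in> ?I" if y: "y \<in> V" for y
    proof -
      obtain x where x: "x \<in> fst c" "\<psi> y = snd c x" using \<psi>U(1)[OF y] UQ by blast
      then show ?thesis using inv chart_inj_on[OF M D(1)] by (auto simp: inj_on_eq_iff)
    qed
    then have "snd e ` (fst e \<inter> V \<inter> inv_into W f -` fst b) = ?O"
      using V(2) by (auto simp: e d invf inv)
    with * show "smooth_on (snd e ` (fst e \<inter> V \<inter> inv_into W f -` fst b)) (snd b \<circ> inv_into W f \<circ> chart_inv e)" by simp
  qed
  have main: "tangent_map S T f x (drift S x) = drift T (f x) \<and>
        tangent_map S T f x ` (affdist S `` {x}) = affdist T `` {f x} \<and>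
        (\<forall>v\<in>affdist S `` {x}. cost T (f x, tangent_map S T f x v) = cost S (x, v))" if x: "x \<in> W" for x
  proof -
    have xc: "x \<in> fst c" "snd c x \<in> U" "snd c x \<in> Q" using x U(2) unfolding W_def by auto
    have fx: "f x \<in> \<Omega>" using fW[OF x] V(2) by blast
    let ?L = "frechet_derivative \<phi> (at (snd c x))"
    note \<phi>d = smooth_on_has_derivative[OF sm(1) xc(2)]
    have lin: "linear ?L" using \<phi>d has_derivative_linear by blast
    have "((snd ?d \<circ> f \<circ> chart_inv c) has_derivative ?L) (at (snd c x))"
    proof (rule has_derivative_transform_within_open[OF \<phi>d U(1) xc(2)])
      fix y assume "y \<in> U"
      then show "\<phi> y = (snd ?d \<circ> f \<circ> chart_inv c) y" using UQ inv by (auto simp: d f_def)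
    qed
    note fd = this and fd' = frechet_derivative_at[OF this, symmetric]
    have tm: "tangent_map S T f x v = std_tvec \<Omega> (?L (v c))" if v: "v \<in> tangent_space S x" for v
    proof
      fix e
      show "tangent_map S T f x v e = std_tvec \<Omega> (?L (v c)) e"
      proof (cases "e = ?d")
        case True
        have "tangent_map S T f x v ?d = frechet_derivative (snd ?d \<circ> f \<circ> chart_inv c) (at (snd c x)) (v c)"
          by (rule tangent_map_chart[where f=f, OF M v D(1) xc(1)])
            (use fd fx in \<open>auto simp: atlasT d differentiable_def\<close>)
        then show ?thesis using True by (simp only: fd' std_tvec_standard_chart)
      next
        case False
        then show ?thesis by (simp add: tangent_map_def Let_def atlasT std_tvec_def)
      qed
    qed
    have drx: "drift S x \<in> tangent_space S x" "drift S x c = A (snd c x)" using D(6,7) xc by blast+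
    have tA: "tangent_map S T f x (drift S x) = drift T (f x)"
      using tm[OF drx(1)] by (simp add: drx(2) dA[OF xc(2)] driftT[OF fx]) (simp add: f_def)
    obtain t where t: "t \<in> tangent_space S x" "t c = B (snd c x)"
      "affdist S `` {x} = {drift S x + u *\<^sub>R t | u. True}"
      "\<And>u. cost S (x, drift S x + u *\<^sub>R t) = u\<^sup>2 / 2"
      using D(8)[OF xc(1,3)] by blast
    obtain k where k: "k \<noteq> 0" "?L (B (snd c x)) = k *\<^sub>R v\<^sub>2 (f x)" "k\<^sup>2 * G (f x) = 1"
      using dB[OF xc(2)] unfolding f_def by blast
    note sub = subspace_tangent_space[OF M, of x]
    have tmu: "tangent_map S T f x (drift S x + u *\<^sub>R t) = std_tvec \<Omega> (v\<^sub>1 (f x) + (u * k) *\<^sub>R v\<^sub>2 (f x))" for u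
    proof -
      have "(drift S x + u *\<^sub>R t) c = A (snd c x) + u *\<^sub>R B (snd c x)"
        by (simp add: scaleR_fun_def drx t(2))
      then show ?thesis
        using tm[OF subspace_add[OF sub drx(1) subspace_scale[OF sub t(1), of u]]]
        by (simp add: linear_add[OF lin] linear_cmul[OF lin] dA[OF xc(2)] k(2)) (simp add: f_def)
    qed
    have "affdist T `` {f x} = {std_tvec \<Omega> (v\<^sub>1 (f x) + u *\<^sub>R v\<^sub>2 (f x)) | u. True}"
      unfolding affT using fx by auto
    \<comment> \<open>Since \<open>k\<close> is nonzero, multiplying the control by it only
      reparametrises the line.\<close>
    also have "\<dots> = {std_tvec \<Omega> (v\<^sub>1 (f x) + (u * k) *\<^sub>R v\<^sub>2 (f x)) | u. True}"
    proof (intro equalityI subsetI)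
      fix v assume "v \<in> {std_tvec \<Omega> (v\<^sub>1 (f x) + u *\<^sub>R v\<^sub>2 (f x)) | u. True}"
      then obtain u where "v = std_tvec \<Omega> (v\<^sub>1 (f x) + u *\<^sub>R v\<^sub>2 (f x))" by blast
      then have "v = std_tvec \<Omega> (v\<^sub>1 (f x) + (u / k * k) *\<^sub>R v\<^sub>2 (f x))" using k(1) by simp
      then show "v \<in> {std_tvec \<Omega> (v\<^sub>1 (f x) + (u * k) *\<^sub>R v\<^sub>2 (f x)) | u. True}" by blast
    qed blast
    also have "\<dots> = tangent_map S T f x ` (affdist S `` {x})"
      unfolding t(3) tmu[symmetric] by blast
    finally have aff: "tangent_map S T f x ` (affdist S `` {x}) = affdist T `` {f x}" by simp
    have "cost T (f x, tangent_map S T f x (drift S x + u *\<^sub>R t)) = cost S (x, drift S x + u *\<^sub>R t)" for u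
    proof -
      have "cost T (f x, tangent_map S T f x (drift S x + u *\<^sub>R t)) = 1/2 * G (f x) * (u * k)\<^sup>2"
        unfolding tmu by (rule costT[OF fx])
      also have "\<dots> = (k\<^sup>2 * G (f x)) * u\<^sup>2 / 2" by (simp add: power_mult_distrib)
      finally show ?thesis unfolding t(4) k(3) by simp
    qed
    then show ?thesis using tA aff unfolding t(3) by blast
  qed
  have "point_affine_isometry S T W V f"
    unfolding point_affine_isometry_def diffeomorphism_between_def
    using oW oV homf smf sminv main by blast
  moreover have "p \<in> W" using p unfolding W_def by blast
  ultimately show ?thesis by blast
qed

section \<open>Constant rescaling of a frame, and continuity of the bracket\<close>

lemma coframe_scale:
  assumes co: "coframe S A B \<alpha> \<beta>" and k: "k \<noteq> 0"
  shows "coframe S A (\<lambda>x. k *\<^sub>R B x) \<alpha> (\<lambda>x. inverse k *\<^sub>R \<beta> x)"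
proof -
  note oS = coframeD(1)[OF co]
  have "smooth_on S (\<lambda>x. k *\<^sub>R B x)" "smooth_on S (\<lambda>x. inverse k *\<^sub>R \<beta> x)"
    using co by (intro smooth_on_scaleR smooth_on_const oS; simp add: coframe_def)+
  moreover have "v = (\<alpha> x \<bullet> v) *\<^sub>R A x + (inverse k *\<^sub>R \<beta> x \<bullet> v) *\<^sub>R k *\<^sub>R B x" if "x \<in> S" for x v
  proof -
    have "(inverse k *\<^sub>R \<beta> x \<bullet> v) *\<^sub>R k *\<^sub>R B x = (\<beta> x \<bullet> v) *\<^sub>R B x" using k by simp
    then show ?thesis using coframeD(10)[OF co that, of v] by (simp only:)
  qed
  ultimately show ?thesis
    unfolding coframe_def using coframeD(2,4)[OF co] coframeD(6-9)[OF co] oS k by simp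
qed

lemma bracket_scale:
  assumes "smooth_on S A" "smooth_on S B" "x \<in> S"
  shows "bracket A (\<lambda>x. k *\<^sub>R B x) x = k *\<^sub>R bracket A B x"
proof -
  have "((\<lambda>x. k *\<^sub>R B x) has_derivative (\<lambda>v. k *\<^sub>R frechet_derivative B (at x) v)) (at x)"
    by (rule has_derivative_scaleR_right[OF smooth_on_has_derivative[OF assms(2,3)]])
  from frechet_derivative_at[OF this, symmetric]
  have B: "frechet_derivative (\<lambda>x. k *\<^sub>R B x) (at x) v = k *\<^sub>R frechet_derivative B (at x) v" for v by simp
  have "linear (frechet_derivative A (at x))"
    using smooth_on_has_derivative[OF assms(1,3)] has_derivative_linear by blast
  then show ?thesis by (simp add: bracket_def B linear_cmul scaleR_diff_right)
qed

lemma continuous_on_bracket: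
  assumes "open S" "smooth_on S A" "smooth_on S B"
  shows "continuous_on S (bracket A B)"
proof -
  have "continuous_on S (\<lambda>x. frechet_derivative X (at x) (Y x))" if "smooth_on S X" "smooth_on S Y" for X Y :: "'a \<Rightarrow> 'a"
    using has_derivative_apply_field[OF assms(1) _ that]
    by (intro continuous_at_imp_continuous_on ballI) (rule has_derivative_continuous)
  then show ?thesis unfolding bracket_def[abs_def] using assms by (intro continuous_on_diff)
qed

theorem theorem2p2:
  fixes S :: "('m, real^2) affine_structure"
  assumes "smooth_manifold S"
    and "point_affine_distribution 1 S"
    and "strictly_affine S"
    and "constant_type S"
    and "positive_definite_quadratic_cost 1 S"
    and "homogeneous S"
  shows
    "(\<exists>(c\<^sub>1::real) (\<Omega> :: (real^2) set) T.
        rank1_structure_on \<Omega>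
          (\<lambda>x. axis 1 1)
          (\<lambda>x. axis 2 1)
          (\<lambda>x. exp (2 * c\<^sub>1 * x $ 1)) T \<and>
        locally_equivalent S T)
     \<or>
     (\<exists>(j\<^sub>0::real) (g\<^sub>0::real) (\<Omega> :: (real^2) set) T.
        g\<^sub>0 > 0 \<and> (\<forall>x\<in>\<Omega>. x $ 2 \<noteq> 0) \<and>
        rank1_structure_on \<Omega>
          (\<lambda>x. x $ 2 *\<^sub>R (axis 1 1 + j\<^sub>0 *\<^sub>R axis 2 1))
          (\<lambda>x. x $ 2 *\<^sub>R axis 2 1)
          (\<lambda>x. g\<^sub>0) T \<and>
        locally_equivalent S T)"
    (is "?first \<or> ?second")
proof -
  note M = assms(1)
  have e2: "axis 2 1 \<noteq> (0 :: real^2)" by (simp add: axis_eq_0_iff)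
  have T1: "\<exists>T. rank1_structure_on UNIV (\<lambda>x::real^2. axis 1 1) (\<lambda>x. axis 2 1) (\<lambda>x. exp (2 * c\<^sub>1 * x $ 1)) T" for c\<^sub>1
    using rank1_structure_exists[OF open_UNIV, of "\<lambda>x. axis 2 1"] e2 by metis
  \<comment> \<open>The half-plane suffices, because the second coordinate in the transverse case is
    an exponential.\<close>
  define \<Omega> where "\<Omega> = {y::real^2. y $ 2 > 0}"
  have \<Omega>: "open \<Omega>" unfolding \<Omega>_def by (intro open_Collect_less continuous_intros)
  have T2: "\<exists>T. rank1_structure_on \<Omega> (\<lambda>x::real^2. x $ 2 *\<^sub>R (axis 1 1 + j\<^sub>0 *\<^sub>R axis 2 1)) (\<lambda>x. x $ 2 *\<^sub>R axis 2 1)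
      (\<lambda>x. g\<^sub>0) T" for j\<^sub>0 g\<^sub>0
    using rank1_structure_exists[OF \<Omega>, of "\<lambda>x. x $ 2 *\<^sub>R axis 2 1"] e2 unfolding \<Omega>_def
    by (metis (no_types, lifting) less_irrefl mem_Collect_eq scaleR_eq_0_iff)
  have framed: "\<exists>c Q A B \<alpha> \<beta>. unit_rep S c Q A B \<and> p \<in> fst c \<and> snd c p \<in> Q \<and> coframe Q A B \<alpha> \<beta>"
    if "p \<in> points S" for p
  proof -
    obtain c Q A B where rep: "unit_rep S c Q A B" "p \<in> fst c" "snd c p \<in> Q"
      and ind: "\<And>y a b. y \<in> Q \<Longrightarrow> a *\<^sub>R A y + b *\<^sub>R B y = 0 \<Longrightarrow> a = 0 \<and> b = 0"
      using unit_rep_exists[OF M assms(2,3,5) \<open>p \<in> points S\<close>] by blast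
    obtain \<alpha> \<beta> where "coframe Q A B \<alpha> \<beta>"
      by (rule coframe_exists[OF unit_repD(2,4,5)[OF rep(1)]]) (use ind in blast)+
    with rep show ?thesis by blast
  qed
  show ?thesis
  proof (cases "points S = {}")
    case True
    \<comment> \<open>With no points, every model is locally equivalent; otherwise there is a base
      point at which to read off the constants.\<close>
    then have le: "locally_equivalent S T" for T :: "(real^2, real^2) affine_structure"
      by (simp add: locally_equivalent_def)
    obtain T where T: "rank1_structure_on UNIV (\<lambda>x::real^2. axis 1 1) (\<lambda>x. axis 2 1) (\<lambda>x. exp (2 * 0 * x $ 1)) T"
      using T1 by blast
    have ?first by (intro exI conjI) (rule T le)+
    then show ?thesis ..
  next
    case False
    then obtain q where q: "q \<in> points S" by blast
    obtain c' Q' A' B' \<alpha>' \<beta>' where rep': "unit_rep S c' Q' A' B'" "q \<in> fst c'" "snd c' q \<in> Q'"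
      and co': "coframe Q' A' B' \<alpha>' \<beta>'" using framed[OF q] by blast
    define a where "a = \<alpha>' (snd c' q) \<bullet> bracket A' B' (snd c' q)"
    define b where "b = \<beta>' (snd c' q) \<bullet> bracket A' B' (snd c' q)"
    \<comment> \<open>Homogeneity enters here: an isometry from any point to \<open>q\<close>
      compares any normalised frame with the reference frame. All normalised frames are covered,
      since the choice near each point is arbitrary.\<close>
    have coeff: "\<beta> y \<bullet> bracket A B y = b" "(\<alpha> y \<bullet> bracket A B y)\<^sup>2 = a\<^sup>2"
      if rep: "unit_rep S c Q A B" and co: "coframe Q A B \<alpha> \<beta>" and y: "y \<in> Q" for c Q A B \<alpha> \<beta> y
    proof -
      obtain x where x: "x \<in> fst c" "snd c x = y" using unit_repD(3)[OF rep] y by blast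
      have "x \<in> points S" using chart_topspace(1)[OF M unit_repD(1)[OF rep]] x(1) by blast
      then obtain U V f where f: "x \<in> U" "f x = q" "point_affine_isometry S S U V f"
        using assms(6) q unfolding homogeneous_def by blast
      have xq: "snd c x \<in> Q" "f x \<in> fst c'" "snd c' (f x) \<in> Q'" using x y f rep' by simp_all
      obtain R F where R: "open R" "snd c x \<in> R" "R \<subseteq> Q" "smooth_on R F" "F ` R \<subseteq> Q'" "F (snd c x) = snd c' (f x)"
        "\<And>y. y \<in> R \<Longrightarrow> frechet_derivative F (at y) (A y) = A' (F y)"
        "\<And>y. y \<in> R \<Longrightarrow> \<exists>e. e\<^sup>2 = 1 \<and> frechet_derivative F (at y) (B y) = e *\<^sub>R B' (F y)"
        using isometry_in_charts[OF M rep rep'(1) f(3,1) x(1) xq] by blast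
      show "\<beta> y \<bullet> bracket A B y = b" "(\<alpha> y \<bullet> bracket A B y)\<^sup>2 = a\<^sup>2"
        using bracket_coefficients_invariant[OF co co' R(1-5,7,8)] R(6) f(2) x(2)
        unfolding a_def b_def by simp_all
    qed
    show ?thesis
    proof (cases "a = 0")
      case True
      \<comment> \<open>The unit field becomes exp(b x_1) times the second coordinate field, so the
        latter has cost coefficient exp(-2 b x_1), that is, c_1 = -b.\<close>
      obtain T where T: "rank1_structure_on UNIV (\<lambda>x::real^2. axis 1 1) (\<lambda>x. axis 2 1) (\<lambda>x. exp (2 * (- b) * x $ 1)) T"
        using T1 by blast
      have "\<exists>U V f. p \<in> U \<and> point_affine_isometry S T U V f" if p: "p \<in> points S" for p
      proof -
        obtain c Q A B \<alpha> \<beta> where rep: "unit_rep S c Q A B" "p \<in> fst c" "snd c p \<in> Q"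
          and co: "coframe Q A B \<alpha> \<beta>" using framed[OF p] by blast
        obtain r where r: "r > 0" "ball (snd c p) r \<subseteq> Q"
          using unit_repD(2)[OF rep(1)] rep(3) open_contains_ball by blast
        have "bracket A B x = b *\<^sub>R B x" if "x \<in> ball (snd c p) r" for x
        proof -
          have xQ: "x \<in> Q" using that r by blast
          have "\<alpha> x \<bullet> bracket A B x = 0" "\<beta> x \<bullet> bracket A B x = b"
            using coeff[OF rep(1) co xQ] True by simp_all
          then show ?thesis using coframeD(10)[OF co xQ, of "bracket A B x"] by simp
        qed
        from normal_form_bracket_tangent[OF coframe_subset[OF co r(2) open_ball] convex_ball _ this]
        obtain U V and \<phi> \<psi> :: "real^2 \<Rightarrow> real^2" where n: "open U" "snd c p \<in> U" "U \<subseteq> ball (snd c p) r" "open V" "homeomorphism U V \<phi> \<psi>"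
          "smooth_on U \<phi>" "smooth_on V \<psi>"
          "\<And>x. x \<in> U \<Longrightarrow> frechet_derivative \<phi> (at x) (A x) = axis 1 1"
          "\<And>x. x \<in> U \<Longrightarrow> frechet_derivative \<phi> (at x) (B x) = exp (b * \<phi> x $ 1) *\<^sub>R axis 2 1"
          using r(1) by (metis centre_in_ball)
        show ?thesis
        proof (rule local_isometry_to_model[OF M rep(1,2) n(2) T n(1) _ n(4) subset_UNIV n(5-7) n(8)])
          show "U \<subseteq> Q" using n(3) r(2) by blast
          fix y assume "y \<in> U"
          then show "\<exists>k. k \<noteq> 0 \<and> frechet_derivative \<phi> (at y) (B y) = k *\<^sub>R axis 2 1 \<and>
              k\<^sup>2 * exp (2 * - b * \<phi> y $ 1) = 1"
            by (intro exI[of _ "exp (b * \<phi> y $ 1)"]) (simp add: n(9) power2_eq_square flip: exp_add)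
        qed
      qed
      then have le: "locally_equivalent S T" unfolding locally_equivalent_def by blast
      have ?first by (intro exI conjI) (rule T le)+
      then show ?thesis ..
    next
      case False
      \<comment> \<open>The model field is the unit field divided by plus or minus \<open>a\<close>,
        hence has cost coefficient 1/a^2 whichever sign occurs; this lets one model serve all
        points.\<close>
      obtain T where T: "rank1_structure_on \<Omega> (\<lambda>x. x $ 2 *\<^sub>R (axis 1 1 + b *\<^sub>R axis 2 1)) (\<lambda>x. x $ 2 *\<^sub>R axis 2 1)
          (\<lambda>x. 1 / a\<^sup>2) T"
        using T2 by blast
      have "\<exists>U V f. p \<in> U \<and> point_affine_isometry S T U V f" if p: "p \<in> points S" for p
      proof -
        obtain c Q A B \<alpha> \<beta> where rep: "unit_rep S c Q A B" "p \<in> fst c" "snd c p \<in> Q"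
          and co: "coframe Q A B \<alpha> \<beta>" using framed[OF p] by blast
        note c = coframeD[OF co]
        define h where "h x = \<alpha> x \<bullet> bracket A B x" for x
        define k where "k = h (snd c p)"
        have hk: "(h x)\<^sup>2 = a\<^sup>2" if "x \<in> Q" for x using coeff(2)[OF rep(1) co that] by (simp add: h_def)
        have k: "k\<^sup>2 = a\<^sup>2" "k \<noteq> 0" using hk[OF rep(3)] False by (auto simp: k_def)
        have "continuous_on Q h" unfolding h_def
          by (intro continuous_on_inner smooth_on_continuous[OF c(4)] continuous_on_bracket c(1-3))
        then have "continuous_on Q (\<lambda>x. h x * k)" by (intro continuous_intros)
        from continuous_open_preimage[OF this c(1) open_greaterThan[of 0]]
        have "open (Q \<inter> (\<lambda>x. h x * k) -` {0<..})" .
        moreover have "snd c p \<in> Q \<inter> (\<lambda>x. h x * k) -` {0<..}"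
          using rep(3) k(2) by (simp flip: k_def add: not_square_less_zero less_le)
        ultimately obtain r where r: "r > 0" "ball (snd c p) r \<subseteq> Q \<inter> (\<lambda>x. h x * k) -` {0<..}"
          using open_contains_ball by blast
        have rQ: "ball (snd c p) r \<subseteq> Q" using r(2) by blast
        \<comment> \<open>The square is constant by homogeneity, and on this ball the sign is that
          of \<open>k\<close> by continuity.\<close>
        have h: "h x = k" if "x \<in> ball (snd c p) r" for x
        proof -
          have "(h x)\<^sup>2 = k\<^sup>2" "h x * k > 0" using hk k(1) that r(2) by auto
          then show ?thesis unfolding power2_eq_iff by (auto simp: zero_less_mult_iff)
        qed
        \<comment> \<open>Scaling \<open>B\<close> by \<open>l\<close> multiplies the bracket by
          \<open>l\<close>: the coefficient of \<open>A\<close> becomes -1, and that of the field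
          itself stays \<open>b\<close>.\<close>
        define l where "l = - inverse k"
        have l: "l \<noteq> 0" "l * k = -1" using k(2) by (simp_all add: l_def)
        define B\<^sub>1 where "B\<^sub>1 x = l *\<^sub>R B x" for x
        have co1: "coframe (ball (snd c p) r) A B\<^sub>1 \<alpha> (\<lambda>x. inverse l *\<^sub>R \<beta> x)"
          unfolding B\<^sub>1_def using coframe_scale[OF coframe_subset[OF co rQ open_ball] l(1)] .
        have "bracket A B\<^sub>1 x = b *\<^sub>R B\<^sub>1 x - A x" if x: "x \<in> ball (snd c p) r" for x
        proof -
          have xQ: "x \<in> Q" using x rQ by blast
          have "bracket A B x = k *\<^sub>R A x + b *\<^sub>R B x"
            using c(10)[OF xQ, of "bracket A B x"] coeff(1)[OF rep(1) co xQ] h[OF x] by (simp add: h_def)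
          then have "bracket A B\<^sub>1 x = (l * k) *\<^sub>R A x + (l * b) *\<^sub>R B x"
            unfolding B\<^sub>1_def bracket_scale[OF c(2,3) xQ] by (simp add: scaleR_add_right)
          then show ?thesis unfolding l(2) by (simp add: B\<^sub>1_def mult.commute)
        qed
        from normal_form_bracket_transverse[OF co1 convex_ball _ this]
        obtain U V and \<phi> \<psi> :: "real^2 \<Rightarrow> real^2" where n: "open U" "snd c p \<in> U" "U \<subseteq> ball (snd c p) r" "open V"
          "V \<subseteq> \<Omega>" "homeomorphism U V \<phi> \<psi>" "smooth_on U \<phi>" "smooth_on V \<psi>"
          "\<And>x. x \<in> U \<Longrightarrow> frechet_derivative \<phi> (at x) (A x) = \<phi> x $ 2 *\<^sub>R (axis 1 1 + b *\<^sub>R axis 2 1)"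
          "\<And>x. x \<in> U \<Longrightarrow> frechet_derivative \<phi> (at x) (B\<^sub>1 x) = \<phi> x $ 2 *\<^sub>R axis 2 1"
          unfolding \<Omega>_def using r(1) by (metis centre_in_ball)
        show ?thesis
        proof (rule local_isometry_to_model[OF M rep(1,2) n(2) T n(1) _ n(4-8) n(9)])
          show "U \<subseteq> Q" using n(3) rQ by blast
          fix y assume y: "y \<in> U"
          have "y \<in> Q" using y n(3) rQ by blast
          then have "linear (frechet_derivative \<phi> (at y))"
            using smooth_on_has_derivative[OF n(7) y] has_derivative_linear by blast
          moreover have "B y = (- k) *\<^sub>R B\<^sub>1 y" using k(2) by (simp add: B\<^sub>1_def l_def)
          ultimately have "frechet_derivative \<phi> (at y) (B y) = (- k) *\<^sub>R (\<phi> y $ 2 *\<^sub>R axis 2 1)"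
            using n(10)[OF y] by (simp only: linear_cmul)
          then show "\<exists>k. k \<noteq> 0 \<and> frechet_derivative \<phi> (at y) (B y) = k *\<^sub>R \<phi> y $ 2 *\<^sub>R axis 2 1 \<and>
              k\<^sup>2 * (1 / a\<^sup>2) = 1"
            using k False by (intro exI[of _ "- k"]) simp
        qed
      qed
      then have le: "locally_equivalent S T" unfolding locally_equivalent_def by blast
      have pos: "1 / a\<^sup>2 > 0" "\<forall>x\<in>\<Omega>. x $ 2 \<noteq> 0" using False by (auto simp: \<Omega>_def)
      have ?second by (intro exI conjI) (rule pos T le)+
      then show ?thesis ..
    qed
  qed
qed

end
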